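(* For every real $k\in(0,1)$, $$\sum_{n=0}^\infty \frac{(\frac14)_n(\frac34)_n}{n!^2}\,P_n\!\left(\frac{(1+k)(1-4k+7k^2)}{(1-3k)(1+3k^2)}\right)\left(\frac{(1+k)(1-3k)(1+3k^2)}{(1+3k)^2}\right)^n\bigl(C_3n^3+C_2n^2+C_1n+C_0\bigr)=\frac{3\sqrt2\,(1+3k)^{5/2}(1+3k^2)}{(1+k)\pi},$$ where $$C_3=\frac{16(k-1)^2k^2}{(1+k)^2}(8+15k+9k^2)^2,$$ $$C_2=48(k-1)k(8-15k+27k^2+27k^3+81k^4),$$ $$C_1=(4-33k+45k^2)(4-17k+17k^2-3k^3+63k^4),$$ $$C_0=3(1-3k)^4(1+k+2k^2).$$ At the single value $k=\tfrac13$, the product $P_n(\cdot)\,(\cdot)^n$ in each summand is understood as its limit as $k\to\tfrac13$.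
   Context: $P_n$ denotes the $n$-th Legendre polynomial, $P_n(x)={}_2F_1\bigl(-n,n+1;1;\tfrac{1-x}{2}\bigr)$, evaluated at any real $x$ (possibly $|x|>1$). $(a)_n=a(a+1)\cdots(a+n-1)$, $(a)_0=1$, is the Pochhammer symbol. *)

theory Defs
  imports "HOL-Analysis.Analysis"
begin

(* 2F1(-n, n+1; 1; (1-x)/2). The series terminates, since pochhammer (- real n) j = 0
   for j > n, so the value is meaningful for every real x. *)
definition legendre :: "nat \<Rightarrow> real \<Rightarrow> real" where
  "legendre n x = eval_fps (fps_hypergeo [- real n, real n + 1] [1] 1) ((1 - x) / 2)"

definition legendre_factor :: "nat \<Rightarrow> real \<Rightarrow> real" where
  "legendre_factor n k =
     legendre n ((1 + k) * (1 - 4 * k + 7 * k^2) / ((1 - 3 * k) * (1 + 3 * k^2))) *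
     ((1 + k) * (1 - 3 * k) * (1 + 3 * k^2) / (1 + 3 * k)^2) ^ n"

(* At k = 1/3 the argument of the Legendre polynomial has a pole while the base of the
   n-th power vanishes; the product is there given its limiting value. *)
definition legendre_term :: "nat \<Rightarrow> real \<Rightarrow> real" where
  "legendre_term n k =
     (if k = 1/3 then Lim (at (1/3)) (legendre_factor n) else legendre_factor n k)"

definition C3 :: "real \<Rightarrow> real" where
  "C3 k = 16 * (k - 1)^2 * k^2 / (1 + k)^2 * (8 + 15 * k + 9 * k^2)^2"

definition C2 :: "real \<Rightarrow> real" where
  "C2 k = 48 * (k - 1) * k * (8 - 15 * k + 27 * k^2 + 27 * k^3 + 81 * k^4)"

definition C1 :: "real \<Rightarrow> real" where
  "C1 k = (4 - 33 * k + 45 * k^2) * (4 - 17 * k + 17 * k^2 - 3 * k^3 + 63 * k^4)"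

definition C0 :: "real \<Rightarrow> real" where
  "C0 k = 3 * (1 - 3 * k)^4 * (1 + k + 2 * k^2)"

end

theory Submission
  imports Defs
begin

text \<open>Put \<open>F x = 2F1(1/4, 3/4; 1; x)\<close>, \<open>X = k^2\<close> and \<open>Y = ((1 - k) / (1 + 3 * k))^2\<close>. The summand
  \<open>P\<^sub>n(x) * z^n\<close> is a form of degree \<open>n\<close> in \<open>u = (x - 1) * z / 2\<close> and \<open>v = (x + 1) * z / 2\<close>, and here
  \<open>u = X * (1 - Y)\<close>, \<open>v = Y * (1 - X)\<close>. Bailey's formula evaluates the series without the cubic factor
  as \<open>F X * F Y\<close>. A factor \<open>n\<close> acts as the Euler operator in \<open>(u, v)\<close>, so with the hypergeometric
  equation the full series becomes a bilinear form in \<open>(F X, F' X)\<close> and \<open>(F Y, F' Y)\<close>. The cubic is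
  chosen such that this form is an elementary multiple of the Wronskian of two solutions, as functions
  of \<open>k\<close>, of one second-order equation (Legendre's relation); its constant value comes from
  \<open>k \<longrightarrow> 0\<close>, where the logarithmic singularity of \<open>F\<close> at \<open>1\<close> contributes \<open>sin (pi / 4) / pi\<close>.\<close>

section \<open>The hypergeometric function\<close>

text \<open>The coefficients of 2F1(s, 1 - s; 1; x). The parameter stays general up to Legendre's
  relation, where it becomes 1/4.\<close>

definition hcoeff :: "real \<Rightarrow> nat \<Rightarrow> real" where
  "hcoeff s n = pochhammer s n * pochhammer (1 - s) n / (fact n)^2"

definition hfun :: "real \<Rightarrow> real \<Rightarrow> real" where
  "hfun s x = (\<Sum>n. hcoeff s n * x ^ n)"

definition hderiv :: "real \<Rightarrow> real \<Rightarrow> real" where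
  "hderiv s x = (\<Sum>n. diffs (hcoeff s) n * x ^ n)"

lemma hcoeff_0 [simp]: "hcoeff s 0 = 1"
  by (simp add: hcoeff_def)

lemma hcoeff_Suc: "real (Suc n) ^ 2 * hcoeff s (Suc n) = (real n + s) * (real n + 1 - s) * hcoeff s n"
proof -
  have "fact (Suc n) ^ 2 = real (Suc n) ^ 2 * (fact n) ^ 2"
    by (simp add: power_mult_distrib)
  then show ?thesis
    by (simp add: hcoeff_def pochhammer_Suc del: fact_Suc of_nat_Suc) (simp add: algebra_simps)
qed

lemma hcoeff_nonneg:
  assumes "0 < s" "s < 1"
  shows "0 \<le> hcoeff s n"
  unfolding hcoeff_def using assms by (intro divide_nonneg_nonneg mult_nonneg_nonneg pochhammer_nonneg) auto

lemma hcoeff_decreasing: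
  assumes "0 < s" "s < 1"
  shows "hcoeff s (Suc n) \<le> hcoeff s n"
proof -
  have "real (Suc n) ^ 2 - (real n + s) * (real n + 1 - s) = real n + (1 - s) + s ^ 2"
    by (simp add: power2_eq_square algebra_simps)
  then have "(real n + s) * (real n + 1 - s) \<le> real (Suc n) ^ 2"
    using assms by (smt (verit) of_nat_0_le_iff zero_le_power2)
  then have "real (Suc n) ^ 2 * hcoeff s (Suc n) \<le> real (Suc n) ^ 2 * hcoeff s n"
    unfolding hcoeff_Suc by (rule mult_right_mono) (rule hcoeff_nonneg[OF assms])
  then show ?thesis
    by simp
qed

lemma hcoeff_le_1:
  assumes "0 < s" "s < 1"
  shows "hcoeff s n \<le> 1"
proof (induction n)
  case (Suc n)
  then show ?case
    using hcoeff_decreasing[OF assms, of n] by linarith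
qed simp

lemma summable_hcoeff:
  assumes "0 < s" "s < 1" "\<bar>x\<bar> < 1"
  shows "summable (\<lambda>n. hcoeff s n * x ^ n)"
proof (rule summable_comparison_test')
  show "summable (\<lambda>n. \<bar>x\<bar> ^ n)"
    using assms by (simp add: summable_geometric)
  show "norm (hcoeff s n * x ^ n) \<le> \<bar>x\<bar> ^ n" for n
    using hcoeff_nonneg[OF assms(1,2), of n] hcoeff_le_1[OF assms(1,2), of n]
    by (simp add: abs_mult power_abs mult_left_le_one_le)
qed

lemma hfun_sums:
  assumes "0 < s" "s < 1" "\<bar>x\<bar> < 1"
  shows "(\<lambda>n. hcoeff s n * x ^ n) sums hfun s x"
  unfolding hfun_def by (rule summable_sums[OF summable_hcoeff[OF assms]])

lemma hfun_0 [simp]: "hfun s 0 = 1"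
  using powser_sums_zero[of "hcoeff s"] by (simp add: hfun_def sums_iff)

lemma hfun_ge_1:
  assumes "0 < s" "s < 1" "0 \<le> x" "x < 1"
  shows "1 \<le> hfun s x"
proof -
  have "sum (\<lambda>n. hcoeff s n * x ^ n) {0} \<le> (\<Sum>n. hcoeff s n * x ^ n)"
    using assms by (intro sum_le_suminf summable_hcoeff) (auto intro!: mult_nonneg_nonneg hcoeff_nonneg)
  then show ?thesis
    by (simp add: hfun_def)
qed

lemma hfun_mono:
  assumes "0 < s" "s < 1" "0 \<le> x" "x \<le> y" "y < 1"
  shows "hfun s x \<le> hfun s y"
  unfolding hfun_def using assms
  by (intro suminf_le summable_hcoeff mult_left_mono power_mono hcoeff_nonneg) auto

section \<open>Derivative and hypergeometric equation\<close>

lemma DERIV_hfun: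
  assumes "0 < s" "s < 1" "\<bar>x\<bar> < 1"
  shows "(hfun s has_real_derivative hderiv s x) (at x)"
  using termdiffs_strong'[of 1 "hcoeff s" x] summable_hcoeff[OF assms(1,2)] assms(3)
  by (simp add: hfun_def[abs_def] hderiv_def)

lemma hderiv_sums:
  assumes "0 < s" "s < 1" "\<bar>x\<bar> < 1"
  shows "(\<lambda>n. diffs (hcoeff s) n * x ^ n) sums hderiv s x"
  unfolding hderiv_def
  using termdiff_converges[of x 1 "hcoeff s"] summable_hcoeff[OF assms(1,2)] assms(3)
  by (intro summable_sums) auto

lemma DERIV_hfun_comp [derivative_intros]:
  assumes "(g has_real_derivative g') (at x within A)" "0 < s" "s < 1" "\<bar>g x\<bar> < 1"
  shows "((\<lambda>x. hfun s (g x)) has_real_derivative hderiv s (g x) * g') (at x within A)"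
  using DERIV_chain2[OF DERIV_hfun[OF assms(2-4)] assms(1)] .

text \<open>Multiplying by 1 - x turns coefficients into their differences. Both the differential
  equation and the Abelian limit rest on this.\<close>

lemma powser_times_one_minus:
  fixes b :: "nat \<Rightarrow> real"
  assumes "(\<lambda>n. b n * x ^ n) sums S"
  shows "(\<lambda>n. (b (Suc n) - b n) * x ^ Suc n) sums ((1 - x) * S - b 0)"
proof -
  have "(\<lambda>n. b (Suc n) * x ^ Suc n) sums (S - b 0)"
    using assms sums_Suc_iff[of "\<lambda>n. b n * x ^ n" "S - b 0"] by simp
  from sums_diff[OF this sums_mult2[OF assms, of x]] show ?thesis
    by (simp add: algebra_simps)
qed

text \<open>The recurrence of \<open>hcoeff\<close> collapses the differences of the coefficients of
  \<open>hderiv s\<close>. What results is the series of \<open>s * (1 - s) * hfun s\<close>,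
  integrated termwise from 0.\<close>

lemma hfun_ode_sums:
  assumes s: "0 < s" "s < 1" and x: "\<bar>x\<bar> < 1"
  shows "(\<lambda>n. (s * (1 - s) * hcoeff s n / real (Suc n)) * x ^ Suc n) sums (x * (1 - x) * hderiv s x)"
proof -
  have "diffs (hcoeff s) (Suc n) - diffs (hcoeff s) n = s * (1 - s) * hcoeff s (Suc n) / real (Suc (Suc n))" for n
  proof -
    have "real (Suc (Suc n)) * (diffs (hcoeff s) (Suc n) - diffs (hcoeff s) n) = s * (1 - s) * hcoeff s (Suc n)"
      using hcoeff_Suc[of "Suc n" s] by (simp add: diffs_def power2_eq_square algebra_simps)
    then show ?thesis
      by (simp add: nonzero_eq_divide_eq mult.commute del: of_nat_Suc)
  qed
  then have "(\<lambda>n. s * (1 - s) * hcoeff s (Suc n) / real (Suc (Suc n)) * x ^ Suc n) sums ((1 - x) * hderiv s x - s * (1 - s))"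
    using powser_times_one_minus[OF hderiv_sums[OF assms]] hcoeff_Suc[of 0 s]
    by (simp add: diffs_def)
  then have "(\<lambda>n. s * (1 - s) * hcoeff s n / real (Suc n) * x ^ n) sums ((1 - x) * hderiv s x)"
    using sums_Suc_iff[of "\<lambda>n. s * (1 - s) * hcoeff s n / real (Suc n) * x ^ n"] by simp
  from sums_mult[OF this, of x] show ?thesis
    by (simp add: algebra_simps)
qed

text \<open>The hypergeometric equation in self-adjoint form, which avoids a second derivative of
  \<open>hfun\<close>; it is the preceding series differentiated termwise.\<close>

lemma hfun_ode:
  assumes s: "0 < s" "s < 1" and x: "\<bar>x\<bar> < 1"
  shows "((\<lambda>x. x * (1 - x) * hderiv s x) has_real_derivative s * (1 - s) * hfun s x) (at x)"
proof -
  define c where "c n = (case n of 0 \<Rightarrow> 0 | Suc m \<Rightarrow> s * (1 - s) * hcoeff s m / real (Suc m))" for n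
  have c: "(\<lambda>n. c n * y ^ n) sums (y * (1 - y) * hderiv s y)" if "\<bar>y\<bar> < 1" for y
    using hfun_ode_sums[OF s that] sums_Suc_iff[of "\<lambda>n. c n * y ^ n"] by (simp add: c_def)
  have d: "diffs c = (\<lambda>n. s * (1 - s) * hcoeff s n)"
    by (auto simp: diffs_def c_def simp del: of_nat_Suc)
  have "((\<lambda>y. \<Sum>n. c n * y ^ n) has_real_derivative (\<Sum>n. diffs c n * x ^ n)) (at x)"
    using c x by (intro termdiffs_strong'[of 1]) (auto simp: sums_iff)
  also have "(\<Sum>n. diffs c n * x ^ n) = s * (1 - s) * hfun s x"
    using sums_mult[OF hfun_sums[OF assms], of "s * (1 - s)"] by (simp add: d sums_iff mult.assoc)
  finally show ?thesis
  proof (rule has_field_derivative_transform_within_open[of _ _ _ "{-1<..<1}"])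
    show "(\<Sum>n. c n * y ^ n) = y * (1 - y) * hderiv s y" if "y \<in> {-1<..<1}" for y
      using c[of y] that by (auto simp: sums_iff)
  qed (use x in auto)
qed

lemma DERIV_hfun_ode [derivative_intros]:
  assumes "(g has_real_derivative g') (at x)" "0 < s" "s < 1" "\<bar>g x\<bar> < 1"
  shows "((\<lambda>x. g x * (1 - g x) * hderiv s (g x)) has_real_derivative s * (1 - s) * hfun s (g x) * g') (at x)"
  using DERIV_chain2[OF hfun_ode[OF assms(2-4)] assms(1)] .

text \<open>An Abelian theorem: telescoping makes the monotonicity of \<open>b\<close> an absolute convergence
  statement for the power series of \<open>(1 - x) * (\<Sum>n. b n * x ^ n)\<close>.\<close>

lemma abel_monoseq_limit:
  fixes b :: "nat \<Rightarrow> real"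
  assumes lim: "b \<longlonglongrightarrow> L" and mono: "monoseq b"
    and f: "\<And>x. 0 \<le> x \<Longrightarrow> x < 1 \<Longrightarrow> (\<lambda>n. b n * x ^ n) sums f x"
  shows "((\<lambda>x. (1 - x) * f x) \<longlongrightarrow> L) (at_left 1)"
proof -
  define d where "d n = b (Suc n) - b n" for n
  define D where "D x = b 0 + (\<Sum>n. d n * x ^ Suc n)" for x
  have d: "d sums (L - b 0)"
    unfolding d_def by (rule telescope_sums[OF lim])
  have sd: "summable (\<lambda>n. \<bar>d n\<bar>)"
  proof -
    consider "\<And>n. d n \<ge> 0" | "\<And>n. d n \<le> 0"
      using mono by (auto simp: monoseq_Suc d_def)
    then show ?thesis
      using summable_minus[OF sums_summable[OF d]] sums_summable[OF d] by cases auto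
  qed
  \<comment> \<open>Uniform convergence on the closed interval makes \<open>D\<close> continuous up
    to 1, where the telescoped series has the value \<open>L\<close>.\<close>
  have "continuous_on {0..1} (\<lambda>x. \<Sum>n. d n * x ^ Suc n)"
  proof (rule uniform_limit_theorem)
    show "uniform_limit {0..1} (\<lambda>n x. \<Sum>i<n. d i * x ^ Suc i) (\<lambda>x. \<Sum>i. d i * x ^ Suc i) sequentially"
      using sd by (rule Weierstrass_m_test_ev[rotated])
        (auto intro!: eventuallyI mult_right_le_one_le power_le_one mult_le_one simp: abs_mult)
  qed (auto intro!: always_eventually continuous_intros)
  then have "continuous_on {0..1} D"
    unfolding D_def by (intro continuous_intros)
  then have "(D \<longlongrightarrow> D 1) (at_left 1)"
    by (simp add: continuous_on_Icc_at_leftD)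
  moreover have "D 1 = L"
    using d by (simp add: D_def sums_iff)
  moreover have "eventually (\<lambda>x. D x = (1 - x) * f x) (at_left 1)"
  proof (rule eventually_at_leftI[of 0])
    show "D x = (1 - x) * f x" if "x \<in> {0<..<1}" for x
      using powser_times_one_minus[OF f[of x]] that by (simp add: D_def d_def sums_iff)
  qed simp
  ultimately show ?thesis
    using tendsto_cong by force
qed

section \<open>Asymptotics at the singular point 1\<close>

lemma rGamma_reflection_real: "rGamma s * rGamma (1 - s) = sin (pi * s) / (pi :: real)"
proof -
  have "complex_of_real (rGamma s * rGamma (1 - s)) = complex_of_real (sin (pi * s) / pi)"
    using rGamma_reflection_complex[of "complex_of_real s"]
    by (simp flip: rGamma_complex_of_real sin_of_real)
  then show ?thesis
    by (simp only: of_real_eq_iff)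
qed

text \<open>Multiply Gauss's products for 1 / Gamma(s) and 1 / Gamma(1 - s): the powers n^s and n^(1
  - s) combine to n, and the coefficient appears up to a factor n / (n + 1). The reflection formula
  evaluates the limit.\<close>

lemma diffs_hcoeff_limit: "diffs (hcoeff s) \<longlonglongrightarrow> sin (pi * s) / pi"
proof -
  have "(\<lambda>n. rGamma_series s n * rGamma_series (1 - s) n * (real n / real (Suc n))) \<longlonglongrightarrow>
      rGamma s * rGamma (1 - s) * 1"
    by (intro tendsto_intros LIMSEQ_n_over_Suc_n)
  moreover have "eventually (\<lambda>n. rGamma_series s n * rGamma_series (1 - s) n * (real n / real (Suc n))
      = diffs (hcoeff s) n) sequentially"
    using eventually_gt_at_top[of 0]
  proof eventually_elim
    case (elim n)
    have e: "exp (s * ln (real n)) * exp ((1 - s) * ln (real n)) = real n"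
      using elim by (simp flip: exp_add add: algebra_simps)
    have "rGamma_series s n * rGamma_series (1 - s) n
        = pochhammer s (Suc n) * pochhammer (1 - s) (Suc n) / ((fact n)^2 * real n)"
    proof -
      have "rGamma_series s n * rGamma_series (1 - s) n = pochhammer s (Suc n) * pochhammer (1 - s) (Suc n)
          / ((fact n)^2 * (exp (s * ln (real n)) * exp ((1 - s) * ln (real n))))"
        by (simp add: rGamma_series_def power2_eq_square mult_ac)
      then show ?thesis
        unfolding e .
    qed
    also have "\<dots> * (real n / real (Suc n)) = diffs (hcoeff s) n"
      using elim by (simp add: hcoeff_def diffs_def power2_eq_square divide_simps del: of_nat_Suc)
    finally show ?case .
  qed
  ultimately show ?thesis
    unfolding rGamma_reflection_real using tendsto_cong by force
qed

text \<open>The logarithmic singularity of \<open>hfun s\<close> at 1, read off from the derivative.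
  By the recurrence the coefficients of \<open>hderiv s\<close> increase, so the Abelian theorem
  applies.\<close>

lemma hderiv_asymp:
  assumes "0 < s" "s < 1"
  shows "((\<lambda>x. (1 - x) * hderiv s x) \<longlongrightarrow> sin (pi * s) / pi) (at_left 1)"
proof (rule abel_monoseq_limit[OF diffs_hcoeff_limit])
  have "diffs (hcoeff s) n \<le> diffs (hcoeff s) (Suc n)" for n
  proof -
    have "0 \<le> s * (1 - s) * hcoeff s (Suc n)"
      using assms hcoeff_nonneg[OF assms] by simp
    also have "\<dots> = real (Suc (Suc n)) * (diffs (hcoeff s) (Suc n) - diffs (hcoeff s) n)"
      using hcoeff_Suc[of "Suc n" s] by (simp add: diffs_def power2_eq_square algebra_simps)
    finally show ?thesis
      by (simp add: zero_le_mult_iff del: of_nat_Suc)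
  qed
  then show "monoseq (diffs (hcoeff s))"
    by (simp add: monoseq_Suc)
qed (use assms hderiv_sums in auto)

lemma hfun_asymp:
  assumes "0 < s" "s < 1"
  shows "((\<lambda>x. (1 - x) * hfun s x) \<longlongrightarrow> 0) (at_left 1)"
proof (rule abel_monoseq_limit)
  have "(\<lambda>n. diffs (hcoeff s) n * (1 / real (Suc n))) \<longlonglongrightarrow> sin (pi * s) / pi * 0"
    by (intro tendsto_intros diffs_hcoeff_limit LIMSEQ_Suc[OF lim_1_over_n])
  then have "(\<lambda>n. hcoeff s (Suc n)) \<longlonglongrightarrow> 0"
    by (simp add: diffs_def del: of_nat_Suc)
  then show "hcoeff s \<longlonglongrightarrow> 0"
    by (simp add: filterlim_sequentially_Suc)
  show "monoseq (hcoeff s)"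
    using hcoeff_decreasing[OF assms] by (simp add: monoseq_Suc)
qed (use assms hfun_sums in auto)

section \<open>Bailey's formula\<close>

text \<open>\<open>legendre_hom n u v = P\<^sub>n(x) * z^n\<close> for \<open>u = (x - 1) * z / 2\<close> and \<open>v = (x + 1) * z / 2\<close>;
  unlike \<open>x\<close>, the pair \<open>(u, v)\<close> stays finite when \<open>z = 0\<close>.\<close>

definition legendre_hom :: "nat \<Rightarrow> real \<Rightarrow> real \<Rightarrow> real" where
  "legendre_hom n u v = (\<Sum>j\<le>n. real (n choose j) ^ 2 * u ^ j * v ^ (n - j))"

lemma legendre_hom_scale: "legendre_hom n (t * u) (t * v) = t ^ n * legendre_hom n u v"
  unfolding legendre_hom_def sum_distrib_left
  by (intro sum.cong refl) (simp add: power_mult_distrib mult_ac flip: power_add)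

lemma legendre_hom_0_left: "legendre_hom n 0 v = v ^ n"
proof -
  have "legendre_hom n 0 v = (\<Sum>j\<in>{0}. real (n choose j) ^ 2 * 0 ^ j * v ^ (n - j))"
    unfolding legendre_hom_def by (intro sum.mono_neutral_right) auto
  then show ?thesis
    by simp
qed

lemma legendre_hom_nonneg: "0 \<le> u \<Longrightarrow> 0 \<le> v \<Longrightarrow> 0 \<le> legendre_hom n u v"
  unfolding legendre_hom_def by (intro sum_nonneg mult_nonneg_nonneg) auto

text \<open>The terms are the squares of the binomial terms of \<open>(sqrt u + sqrt v) ^ n\<close>,
  and a sum of squares of nonnegative numbers is at most the square of their sum.\<close>

lemma legendre_hom_le:
  assumes "0 \<le> u" "0 \<le> v"
  shows "legendre_hom n u v \<le> ((sqrt u + sqrt v)^2) ^ n"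
proof -
  define c where "c j = real (n choose j) * sqrt u ^ j * sqrt v ^ (n - j)" for j
  have c: "0 \<le> c j" for j
    using assms by (simp add: c_def)
  have sq: "c j ^ 2 = real (n choose j) ^ 2 * u ^ j * v ^ (n - j)" for j
    using assms by (simp add: c_def power_mult_distrib real_sqrt_power[symmetric])
  have "legendre_hom n u v = (\<Sum>j\<le>n. c j * c j)"
    by (simp add: legendre_hom_def flip: sq power2_eq_square)
  also have "\<dots> \<le> (\<Sum>j\<le>n. c j * (\<Sum>i\<le>n. c i))"
    using c by (intro sum_mono mult_left_mono member_le_sum) auto
  also have "\<dots> = (\<Sum>j\<le>n. c j) ^ 2"
    by (simp add: power2_eq_square sum_distrib_right)
  also have "(\<Sum>j\<le>n. c j) = (sqrt u + sqrt v) ^ n"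
    by (simp add: binomial_ring c_def)
  finally show ?thesis
    by (simp add: power_mult[symmetric] mult.commute)
qed

text \<open>The truncated exponents are harmless: where j - 1 or n - j - 1 is cut off at 0, the
  factor j or n - j vanishes.\<close>

definition legendre_hom_dX :: "nat \<Rightarrow> real \<Rightarrow> real \<Rightarrow> real" where
  "legendre_hom_dX n Y X = (\<Sum>j\<le>n. real (n choose j) ^ 2 * (1 - Y) ^ j * Y ^ (n - j)
     * (real j * X ^ (j - 1) * (1 - X) ^ (n - j) - real (n - j) * X ^ j * (1 - X) ^ (n - j - 1)))"

lemma DERIV_legendre_hom:
  "((\<lambda>X. legendre_hom n (X * (1 - Y)) (Y * (1 - X))) has_real_derivative legendre_hom_dX n Y X) (at X)"
proof -
  have "((\<lambda>X. \<Sum>j\<le>n. real (n choose j) ^ 2 * (1 - Y) ^ j * Y ^ (n - j) * (X ^ j * (1 - X) ^ (n - j)))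
      has_real_derivative legendre_hom_dX n Y X) (at X)"
    unfolding legendre_hom_dX_def by (auto intro!: derivative_eq_intros sum.cong)
  then show ?thesis
    by (simp add: legendre_hom_def power_mult_distrib mult_ac)
qed

text \<open>The operator d/dX X (1 - X) d/dX of the hypergeometric equation reproduces X^j (1 - X)^m
  with the factor - n (n + 1), up to terms of total degree n - 1.\<close>

lemma DERIV_binomial_term:
  fixes X :: real
  assumes "j + m = n"
  shows "((\<lambda>X. X * (1 - X) * (real j * X ^ (j - 1) * (1 - X) ^ m - real m * X ^ j * (1 - X) ^ (m - 1)))
    has_real_derivative (real j ^ 2 * X ^ (j - 1) * (1 - X) ^ m + real m ^ 2 * X ^ j * (1 - X) ^ (m - 1)
      - real n * (real n + 1) * (X ^ j * (1 - X) ^ m))) (at X)"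
proof -
  have eq: "X * (1 - X) * (real j * X ^ (j - 1) * (1 - X) ^ m - real m * X ^ j * (1 - X) ^ (m - 1))
      = real j * X ^ j * (1 - X) ^ Suc m - real m * X ^ Suc j * (1 - X) ^ m" for X :: real
    by (cases j; cases m) (simp_all add: algebra_simps)
  have "((\<lambda>X. real j * X ^ j * (1 - X) ^ Suc m - real m * X ^ Suc j * (1 - X) ^ m) has_real_derivative
      real j * (real j * X ^ (j - 1) * (1 - X) ^ Suc m - real (Suc m) * X ^ j * (1 - X) ^ m)
      - real m * (real (Suc j) * X ^ j * (1 - X) ^ m - real m * X ^ Suc j * (1 - X) ^ (m - 1))) (at X)"
    by (auto intro!: derivative_eq_intros simp: algebra_simps simp del: power_Suc)
  also have "real j * (real j * X ^ (j - 1) * (1 - X) ^ Suc m - real (Suc m) * X ^ j * (1 - X) ^ m)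
      - real m * (real (Suc j) * X ^ j * (1 - X) ^ m - real m * X ^ Suc j * (1 - X) ^ (m - 1))
      = real j ^ 2 * X ^ (j - 1) * (1 - X) ^ m + real m ^ 2 * X ^ j * (1 - X) ^ (m - 1)
      - real n * (real n + 1) * (X ^ j * (1 - X) ^ m)"
    unfolding assms[symmetric] by (cases j; cases m) (simp_all add: algebra_simps power2_eq_square)
  finally show ?thesis
    unfolding eq .
qed

text \<open>Both terms of the second-order operator lower the degree by one, because
  \<open>j * (n choose j) = n * (n - 1 choose j - 1)\<close>.\<close>

lemma sum_binomial_square_lower:
  fixes c d X Z :: real
  shows "(\<Sum>j\<le>n. real (n choose j) ^ 2 * c ^ j * d ^ (n - j)
      * (real j ^ 2 * X ^ (j - 1) * Z ^ (n - j) + real (n - j) ^ 2 * X ^ j * Z ^ (n - j - 1)))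
    = real n ^ 2 * (c + d) * legendre_hom (n - 1) (c * X) (d * Z)"
proof (cases n)
  case (Suc m)
  have b1: "real (Suc m choose Suc j) * real (Suc j) = real (Suc m) * real (m choose j)" for j
    using arg_cong[OF Suc_times_binomial[of j m], of real] by (simp only: of_nat_mult mult.commute)
  have b2: "real (Suc m choose j) * real (Suc m - j) = real (Suc m) * real (m choose j)" for j
    using arg_cong[OF binomial_absorb_comp[of "Suc m" j], of real] by (simp only: of_nat_mult mult.commute diff_Suc_1)
  have "(\<Sum>j\<le>Suc m. real (Suc m choose j) ^ 2 * c ^ j * d ^ (Suc m - j) * (real j ^ 2 * X ^ (j - 1) * Z ^ (Suc m - j)))
      = (\<Sum>j\<le>m. (real (Suc m choose Suc j) * real (Suc j)) ^ 2 * c ^ Suc j * d ^ (m - j) * (X ^ j * Z ^ (m - j)))"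
    by (subst sum.atMost_Suc_shift) (simp add: power_mult_distrib mult_ac del: of_nat_Suc binomial_Suc_Suc power_Suc)
  also have "\<dots> = real (Suc m) ^ 2 * c * legendre_hom m (c * X) (d * Z)"
    unfolding b1 legendre_hom_def sum_distrib_left
    by (intro sum.cong refl) (simp add: power_mult_distrib mult_ac del: of_nat_Suc)
  finally have 1: "(\<Sum>j\<le>Suc m. real (Suc m choose j) ^ 2 * c ^ j * d ^ (Suc m - j) * (real j ^ 2 * X ^ (j - 1) * Z ^ (Suc m - j)))
      = real (Suc m) ^ 2 * c * legendre_hom m (c * X) (d * Z)" .
  have "(\<Sum>j\<le>Suc m. real (Suc m choose j) ^ 2 * c ^ j * d ^ (Suc m - j) * (real (Suc m - j) ^ 2 * X ^ j * Z ^ (Suc m - j - 1)))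
      = (\<Sum>j\<le>m. (real (Suc m choose j) * real (Suc m - j)) ^ 2 * c ^ j * d ^ Suc (m - j) * (X ^ j * Z ^ (m - j)))"
    by (auto intro!: sum.cong simp: power_mult_distrib mult_ac Suc_diff_le
        simp del: of_nat_Suc of_nat_diff binomial_Suc_Suc power_Suc)
  also have "\<dots> = real (Suc m) ^ 2 * d * legendre_hom m (c * X) (d * Z)"
    unfolding b2 legendre_hom_def sum_distrib_left
    by (intro sum.cong refl) (simp add: power_mult_distrib mult_ac del: of_nat_Suc)
  finally have 2: "(\<Sum>j\<le>Suc m. real (Suc m choose j) ^ 2 * c ^ j * d ^ (Suc m - j) * (real (Suc m - j) ^ 2 * X ^ j * Z ^ (Suc m - j - 1)))
      = real (Suc m) ^ 2 * d * legendre_hom m (c * X) (d * Z)" .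
  show ?thesis
    using 1 2 unfolding Suc by (simp add: distrib_left sum.distrib distrib_right del: of_nat_Suc)
qed simp

text \<open>With c = 1 - Y and d = Y the factor c + d of \<open>sum_binomial_square_lower\<close> is
  1. The term of index n - 1 matches \<open>hcoeff_Suc\<close>, because (n + s) (n + 1 - s) = n (n +
  1) + s (1 - s); hence the telescoping in \<open>bailey_sums\<close>.\<close>

lemma legendre_hom_ode:
  "((\<lambda>X. X * (1 - X) * legendre_hom_dX n Y X) has_real_derivative
     (real n ^ 2 * legendre_hom (n - 1) (X * (1 - Y)) (Y * (1 - X))
      - real n * (real n + 1) * legendre_hom n (X * (1 - Y)) (Y * (1 - X)))) (at X)"
proof -
  define c where "c j = real (n choose j) ^ 2 * (1 - Y) ^ j * Y ^ (n - j)" for j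
  have eq: "(\<lambda>X. X * (1 - X) * legendre_hom_dX n Y X) = (\<lambda>X. \<Sum>j\<le>n. c j * (X * (1 - X)
      * (real j * X ^ (j - 1) * (1 - X) ^ (n - j) - real (n - j) * X ^ j * (1 - X) ^ (n - j - 1))))"
    by (simp add: legendre_hom_dX_def c_def sum_distrib_left mult_ac)
  have "((\<lambda>X. X * (1 - X) * legendre_hom_dX n Y X) has_real_derivative
      (\<Sum>j\<le>n. c j * (real j ^ 2 * X ^ (j - 1) * (1 - X) ^ (n - j) + real (n - j) ^ 2 * X ^ j * (1 - X) ^ (n - j - 1)
      - real n * (real n + 1) * (X ^ j * (1 - X) ^ (n - j))))) (at X)"
    unfolding eq by (intro DERIV_sum DERIV_cmult DERIV_binomial_term) simp
  also have "(\<Sum>j\<le>n. c j * (real j ^ 2 * X ^ (j - 1) * (1 - X) ^ (n - j) + real (n - j) ^ 2 * X ^ j * (1 - X) ^ (n - j - 1)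
      - real n * (real n + 1) * (X ^ j * (1 - X) ^ (n - j))))
     = real n ^ 2 * legendre_hom (n - 1) (X * (1 - Y)) (Y * (1 - X))
      - real n * (real n + 1) * legendre_hom n (X * (1 - Y)) (Y * (1 - X))"
    using sum_binomial_square_lower[of n "1 - Y" Y X "1 - X"]
    by (simp add: right_diff_distrib[of "c _"] sum_subtractf)
      (simp add: c_def legendre_hom_def sum_distrib_left power_mult_distrib mult_ac)
  finally show ?thesis .
qed


text \<open>The reason is the identity (1 - u - v)^2 - 4 u v = (1 - X - Y)^2: it gives 2 sqrt(u v) <
  1 - u - v.\<close>

lemma sqrt_sum_less_1:
  fixes X Y :: real
  assumes "0 \<le> X" "0 \<le> Y" "X + Y < 1"
  shows "(sqrt (X * (1 - Y)) + sqrt (Y * (1 - X)))^2 < 1"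
proof -
  define u v where "u = X * (1 - Y)" and "v = Y * (1 - X)"
  have uv: "0 \<le> u" "0 \<le> v"
    using assms by (simp_all add: u_def v_def)
  have "1 - u - v = (1 - X - Y) + 2 * X * Y"
    by (simp add: u_def v_def algebra_simps)
  moreover have "0 \<le> 2 * X * Y"
    using assms by simp
  ultimately have pos: "0 < 1 - u - v"
    using assms by linarith
  have "(1 - u - v)^2 - 4 * (u * v) = (1 - X - Y)^2"
    by (simp add: u_def v_def power2_eq_square algebra_simps)
  moreover have "0 < (1 - X - Y)^2"
    using assms by simp
  ultimately have "4 * (u * v) < (1 - u - v)^2"
    by linarith
  moreover have "(2 * sqrt (u * v))^2 = 4 * (u * v)"
    using uv unfolding power_mult_distrib by simp
  ultimately have "(2 * sqrt (u * v))^2 < (1 - u - v)^2"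
    by (simp only:)
  then have "2 * sqrt (u * v) < 1 - u - v"
    by (rule power2_less_imp_less) (use pos in linarith)
  then show ?thesis
    using uv by (simp add: power2_sum real_sqrt_mult flip: u_def v_def)
qed

text \<open>Bailey's reduction of Appell's \<open>F\<^sub>4\<close>. With \<open>S N\<close> the partial sum, the Wronskian of
  \<open>S N\<close> and \<open>hfun s\<close> as functions of \<open>X\<close> has a telescoping derivative that tends to \<open>0\<close>
  uniformly, so \<open>S N / hfun s\<close> is constant in the limit; at \<open>X = 0\<close> it is the series of
  \<open>hfun s Y\<close>.\<close>

theorem bailey_sums:
  assumes s: "0 < s" "s < 1" and X: "0 \<le> X" and Y: "0 \<le> Y" and XY: "X + Y < 1"
  shows "(\<lambda>n. hcoeff s n * legendre_hom n (X * (1 - Y)) (Y * (1 - X))) sums (hfun s X * hfun s Y)"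
proof (cases "X = 0")
  case True
  then show ?thesis
    using hfun_sums[OF s, of Y] Y XY by (simp add: legendre_hom_0_left)
next
  case False
  with X have X0: "0 < X"
    by simp
  define q where "q n x = legendre_hom n (x * (1 - Y)) (Y * (1 - x))" for n x
  define S where "S N x = (\<Sum>n<N. hcoeff s n * q n x)" for N x
  define dS where "dS N x = (\<Sum>n<N. hcoeff s n * legendre_hom_dX n Y x)" for N x
  define w where "w N x = x * (1 - x) * dS N x * hfun s x - S N x * (x * (1 - x) * hderiv s x)" for N x
  define g where "g x = (sqrt (x * (1 - Y)) + sqrt (Y * (1 - x)))^2" for x
  have "continuous_on {0..X} g"
    unfolding g_def by (intro continuous_intros)
  \<comment> \<open>By compactness the maximum of \<open>g\<close> provides a single geometric ratio
    \<open>r\<close> below 1 for all of [0, X].\<close>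
  then obtain x0 where x0: "x0 \<in> {0..X}" "\<And>x. x \<in> {0..X} \<Longrightarrow> g x \<le> g x0"
    using continuous_attains_sup[of "{0..X}" g] X by auto
  define r where "r = g x0"
  have r: "0 \<le> r" "r < 1"
    using sqrt_sum_less_1[of x0 Y] x0 Y XY by (auto simp: r_def g_def)
  have q: "0 \<le> q n x" "q n x \<le> r ^ n" if "x \<in> {0..X}" for n x
  proof -
    have uv: "0 \<le> x * (1 - Y)" "0 \<le> Y * (1 - x)"
      using that Y XY X by auto
    show "0 \<le> q n x"
      unfolding q_def by (rule legendre_hom_nonneg[OF uv])
    have "q n x \<le> g x ^ n"
      unfolding q_def g_def by (rule legendre_hom_le[OF uv])
    also have "\<dots> \<le> r ^ n"
      using x0(2)[OF that] by (intro power_mono) (auto simp: r_def g_def)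
    finally show "q n x \<le> r ^ n" .
  qed
  have dS: "(S N has_real_derivative dS N x) (at x)" for N x
    unfolding S_def dS_def q_def by (intro DERIV_sum DERIV_cmult DERIV_legendre_hom)
  have tel: "(\<Sum>n<Suc N. hcoeff s n * (real n ^ 2 * q (n - 1) x - real n * (real n + 1) * q n x - s * (1 - s) * q n x))
      = - (real (Suc N) ^ 2 * hcoeff s (Suc N)) * q N x" for N x
  proof (induction N)
    case (Suc N)
    show ?case
      unfolding sum.lessThan_Suc[of _ "Suc N"] Suc.IH
      using arg_cong[OF hcoeff_Suc[of "Suc N" s], of "\<lambda>t. t * q (Suc N) x"]
      by (simp add: algebra_simps power2_eq_square)
  qed (use hcoeff_Suc[of 0 s] in simp)
  have dw: "(w (Suc N) has_real_derivative - (real (Suc N) ^ 2 * hcoeff s (Suc N)) * q N x * hfun s x) (at x)"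
    if "x \<in> {0..X}" for N x
  proof -
    have x1: "\<bar>x\<bar> < 1"
      using that XY Y by auto
    define T where "T = (\<Sum>n<Suc N. hcoeff s n * (real n ^ 2 * q (n - 1) x - real n * (real n + 1) * q n x))"
    have dT: "((\<lambda>x. x * (1 - x) * dS (Suc N) x) has_real_derivative T) (at x)"
    proof -
      have "(\<lambda>x. x * (1 - x) * dS (Suc N) x) = (\<lambda>x. \<Sum>n<Suc N. hcoeff s n * (x * (1 - x) * legendre_hom_dX n Y x))"
        by (simp add: dS_def sum_distrib_left mult_ac del: sum.lessThan_Suc)
      then show ?thesis
        unfolding q_def T_def by (simp only:) (intro DERIV_sum DERIV_cmult legendre_hom_ode)
    qed
    have "T - s * (1 - s) * S (Suc N) x = - (real (Suc N) ^ 2 * hcoeff s (Suc N)) * q N x"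
      unfolding tel[symmetric] S_def T_def sum_distrib_left sum_subtractf[symmetric]
      by (intro sum.cong refl) (simp add: algebra_simps)
    from this[symmetric] have eq: "- (real (Suc N) ^ 2 * hcoeff s (Suc N)) * q N x * hfun s x
        = (T * hfun s x + hderiv s x * (x * (1 - x) * dS (Suc N) x))
        - (dS (Suc N) x * (x * (1 - x) * hderiv s x) + s * (1 - s) * hfun s x * S (Suc N) x)"
      by (simp only:) (simp add: algebra_simps)
    show ?thesis
      using DERIV_diff[OF DERIV_mult[OF dT DERIV_hfun[OF s x1]] DERIV_mult[OF dS[of "Suc N"] hfun_ode[OF s x1]]]
      unfolding w_def eq .
  qed
  define e where "e N = real (Suc N) ^ 2 * r ^ N * hfun s X" for N
  have X1: "X < 1" "\<bar>X\<bar> < 1"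
    using X Y XY by auto
  \<comment> \<open>Since \<open>w\<close> vanishes at 0, the mean value theorem gives a bound with
    a factor x. That factor cancels the 1 / z arising in \<open>est\<close>.\<close>
  have w: "\<bar>w (Suc N) x\<bar> \<le> e N * x" if x: "0 < x" "x \<le> X" for N x
  proof -
    have "\<exists>z. 0 < z \<and> z < x \<and> w (Suc N) x - w (Suc N) 0 = (x - 0) * (- (real (Suc N) ^ 2 * hcoeff s (Suc N)) * q N z * hfun s z)"
      using dw x by (intro MVT2) auto
    then obtain z where z: "0 < z" "z < x"
      "w (Suc N) x = - x * (real (Suc N) ^ 2 * hcoeff s (Suc N) * q N z * hfun s z)"
      by (auto simp: w_def mult_ac)
    have h: "0 \<le> hcoeff s (Suc N)" "hcoeff s (Suc N) \<le> 1"
      by (rule hcoeff_nonneg[OF s], rule hcoeff_le_1[OF s])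
    have hz: "1 \<le> hfun s z" "hfun s z \<le> hfun s X"
      using z x X1 by (auto intro!: hfun_ge_1 hfun_mono s)
    have qz: "0 \<le> q N z" "q N z \<le> r ^ N"
      using q z x by auto
    have "real (Suc N) ^ 2 * hcoeff s (Suc N) * q N z * hfun s z \<le> real (Suc N) ^ 2 * 1 * r ^ N * hfun s X"
      using h hz qz r by (intro mult_mono mult_nonneg_nonneg) auto
    moreover have "0 \<le> real (Suc N) ^ 2 * hcoeff s (Suc N) * q N z * hfun s z"
      using h hz qz by (intro mult_nonneg_nonneg) auto
    ultimately have "\<bar>real (Suc N) ^ 2 * hcoeff s (Suc N) * q N z * hfun s z\<bar> * \<bar>x\<bar> \<le> e N * \<bar>x\<bar>"
      unfolding e_def by (intro mult_right_mono) linarith+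
    then show ?thesis
      using x unfolding z(3) by (simp add: abs_mult mult_ac)
  qed
  \<comment> \<open>The derivative of \<open>S / hfun s\<close> is \<open>w / (z * (1 - z))\<close>
    over the square of \<open>hfun s z\<close>, and \<open>hfun s z\<close> is at least 1.\<close>
  have est: "\<bar>S (Suc N) X / hfun s X - S (Suc N) 0\<bar> \<le> X * (e N / (1 - X))" for N
  proof -
    have pos: "0 < hfun s x" if "x \<in> {0..X}" for x
      using hfun_ge_1[OF s, of x] that X1 by auto
    have "\<exists>z. 0 < z \<and> z < X \<and> S (Suc N) X / hfun s X - S (Suc N) 0 / hfun s 0
        = (X - 0) * ((dS (Suc N) z * hfun s z - S (Suc N) z * hderiv s z) / (hfun s z * hfun s z))"
      using X0 X1 pos by (intro MVT2) (auto intro!: DERIV_divide dS DERIV_hfun s less_imp_neq[symmetric])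
    then obtain z where z: "0 < z" "z < X" "S (Suc N) X / hfun s X - S (Suc N) 0
        = X * ((dS (Suc N) z * hfun s z - S (Suc N) z * hderiv s z) / (hfun s z * hfun s z))"
      by auto
    have "dS (Suc N) z * hfun s z - S (Suc N) z * hderiv s z = w (Suc N) z / (z * (1 - z))"
      using z X1 by (simp add: w_def field_simps)
    also have "\<bar>\<dots>\<bar> = \<bar>w (Suc N) z\<bar> / (z * (1 - z))"
      using z X1 by (simp add: abs_mult)
    also have "\<dots> \<le> e N * z / (z * (1 - z))"
      using w[of z N] z X1 by (intro divide_right_mono) auto
    also have "\<dots> = e N / (1 - z)"
      using z by simp
    also have "\<dots> \<le> e N / (1 - X)"
      using z X1 r hfun_ge_1[OF s, of X] X0 by (intro divide_left_mono) (auto simp: e_def)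
    finally have b: "\<bar>dS (Suc N) z * hfun s z - S (Suc N) z * hderiv s z\<bar> \<le> e N / (1 - X)" .
    have "1 * 1 \<le> hfun s z * hfun s z"
      using hfun_ge_1[OF s, of z] z X1 by (intro mult_mono) auto
    then have "\<bar>(dS (Suc N) z * hfun s z - S (Suc N) z * hderiv s z) / (hfun s z * hfun s z)\<bar>
        \<le> \<bar>dS (Suc N) z * hfun s z - S (Suc N) z * hderiv s z\<bar> / 1"
      unfolding abs_divide by (intro frac_le) auto
    from order.trans[OF this[unfolded div_by_1] b] have
      "\<bar>(dS (Suc N) z * hfun s z - S (Suc N) z * hderiv s z) / (hfun s z * hfun s z)\<bar> \<le> e N / (1 - X)" .
    then show ?thesis
      unfolding z(3) abs_mult abs_of_pos[OF X0] using X by (rule mult_left_mono)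
  qed
  have "e \<longlonglongrightarrow> 0 * hfun s X"
    unfolding e_def
  proof (intro tendsto_mult tendsto_const)
    show "(\<lambda>N. real (Suc N) ^ 2 * r ^ N) \<longlonglongrightarrow> 0"
    proof (rule summable_LIMSEQ_zero)
      \<comment> \<open>The geometric series differentiated twice has coefficients (N + 1) (N + 2),
        which dominate (N + 1)^2.\<close>
      have 0: "summable (\<lambda>N. diffs (diffs (\<lambda>_. 1)) N * r ^ N)"
        using r by (intro termdiff_converges[of _ 1]) (auto simp: summable_geometric)
      show "summable (\<lambda>N. real (Suc N) ^ 2 * r ^ N)"
        by (rule summable_comparison_test'[OF 0])
          (use r in \<open>auto intro!: mult_right_mono simp: diffs_def power2_eq_square algebra_simps\<close>)
    qed
  qed
  then have "(\<lambda>N. X * (e N / (1 - X))) \<longlonglongrightarrow> X * (0 * hfun s X / (1 - X))"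
    by (intro tendsto_intros) (use X1 in auto)
  then have "(\<lambda>N. S (Suc N) X / hfun s X - S (Suc N) 0) \<longlonglongrightarrow> 0"
    by (rule_tac Lim_null_comparison[OF eventuallyI]) (use est in auto)
  moreover have "(\<lambda>N. S (Suc N) 0) \<longlonglongrightarrow> hfun s Y"
    using LIMSEQ_Suc[OF hfun_sums[OF s, of Y, unfolded sums_def]] X Y XY
    by (simp add: S_def q_def legendre_hom_0_left del: sum.lessThan_Suc)
  ultimately have "(\<lambda>N. hfun s X * ((S (Suc N) X / hfun s X - S (Suc N) 0) + S (Suc N) 0)) \<longlonglongrightarrow> hfun s X * (0 + hfun s Y)"
    by (intro tendsto_intros)
  moreover have "hfun s X \<noteq> 0"
    using hfun_ge_1[OF s X X1(1)] by auto
  ultimately have "(\<lambda>N. S (Suc N) X) \<longlonglongrightarrow> hfun s X * hfun s Y"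
    by simp
  from LIMSEQ_imp_Suc[OF this] show ?thesis
    unfolding sums_def S_def q_def .
qed

section \<open>The Euler operator\<close>

text \<open>Writing the derivative as \<open>h1 x / x\<close> makes \<open>h1\<close> the image of
  \<open>h\<close> under the Euler operator, so the lemma can be iterated.\<close>

lemma theta_sums:
  fixes b :: "nat \<Rightarrow> real"
  assumes S: "open S" "\<And>x. x \<in> S \<Longrightarrow> 0 < x"
    and h: "\<And>x. x \<in> S \<Longrightarrow> (\<lambda>n. b n * x ^ n) sums h x"
    and h': "\<And>x. x \<in> S \<Longrightarrow> (h has_real_derivative h1 x / x) (at x)"
    and x: "x \<in> S"
  shows "(\<lambda>n. real n * b n * x ^ n) sums h1 x"
proof -
  have x0: "0 < x"
    using S x by auto
  obtain e where e: "0 < e" "ball x e \<subseteq> S"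
    using openE[OF S(1) x] by auto
  \<comment> \<open>Convergence at a point of \<open>S\<close> beyond x puts x inside the disc of
    convergence, where termwise differentiation is allowed.\<close>
  define K where "K = x + e / 2"
  have K: "x < K" "K \<in> S"
    using e by (auto simp: K_def dist_real_def intro!: subsetD[OF e(2)])
  have sK: "summable (\<lambda>n. b n * K ^ n)"
    using h[OF K(2)] by (rule sums_summable)
  have "((\<lambda>x. \<Sum>n. b n * x ^ n) has_real_derivative (\<Sum>n. diffs b n * x ^ n)) (at x)"
    using sK by (rule termdiffs_strong) (use K x0 in auto)
  then have "(h has_real_derivative (\<Sum>n. diffs b n * x ^ n)) (at x)"
    by (rule has_field_derivative_transform_within_open[OF _ S(1) x]) (use h sums_unique in force)
  with h'[OF x] have "h1 x / x = (\<Sum>n. diffs b n * x ^ n)"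
    by (rule DERIV_unique)
  moreover have "summable (\<lambda>n. diffs b n * x ^ n)"
    by (rule termdiff_converges[of x K]) (use K x0 powser_inside[OF sK] in auto)
  ultimately have "(\<lambda>n. diffs b n * x ^ n) sums (h1 x / x)"
    by (simp add: sums_iff)
  from sums_mult[OF this, of x] have "(\<lambda>n. real (Suc n) * b (Suc n) * x ^ Suc n) sums h1 x"
    using x0 by (simp add: diffs_def mult_ac del: of_nat_Suc)
  then show ?thesis
    using sums_Suc_iff[of "\<lambda>n. real n * b n * x ^ n" "h1 x"] by simp
qed

text \<open>The iterates of \<open>t * d/dt\<close> on \<open>A * B\<close>, when \<open>t * d/dt\<close> maps \<open>x\<close> to \<open>x * (1 - x) * i\<close> and \<open>y\<close> to
  \<open>y * (1 - y) * i\<close> with \<open>i = 1 / (1 - x - y)\<close>. Here \<open>A\<close>, \<open>B\<close> are solutions of the hypergeometric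
  equation at \<open>x\<close>, \<open>y\<close>, further \<open>P = x * (1 - x) * A'\<close>, \<open>R = y * (1 - y) * B'\<close> and \<open>c = s * (1 - s)\<close>.\<close>

definition theta1 :: "real \<Rightarrow> real \<Rightarrow> real \<Rightarrow> real \<Rightarrow> real \<Rightarrow> real" where
  "theta1 i A P B R = (P * B + A * R) * i"

definition theta2 :: "real \<Rightarrow> real \<Rightarrow> real \<Rightarrow> real \<Rightarrow> real \<Rightarrow> real \<Rightarrow> real \<Rightarrow> real \<Rightarrow> real" where
  "theta2 c x y i A P B R =
     (let g = x * (1 - x) + y * (1 - y) in
      (c * g * A * B + 2 * P * R) * i^2 + g * (P * B + A * R) * i^3)"

definition theta3 :: "real \<Rightarrow> real \<Rightarrow> real \<Rightarrow> real \<Rightarrow> real \<Rightarrow> real \<Rightarrow> real \<Rightarrow> real \<Rightarrow> real" where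
  "theta3 c x y i A P B R =
     (let g = x * (1 - x) + y * (1 - y); m = (1 - 2 * x) * (x * (1 - x)) + (1 - 2 * y) * (y * (1 - y)) in
      (c * m * A * B + c * g * (P * B + A * R) + 2 * c * (x * (1 - x) * A * R + y * (1 - y) * P * B)) * i^3
      + (3 * g * (c * g * A * B + 2 * P * R) + m * (P * B + A * R)) * i^4
      + 3 * g^2 * (P * B + A * R) * i^5)"

text \<open>Under t * d/dt the seven functions form a closed polynomial system, in which the
  equation for \<open>i\<close> is that of 1 / (1 - x - y). The iterates then follow from the
  product rule alone.\<close>

lemma DERIV_theta:
  fixes x y i A P B R :: "real \<Rightarrow> real"
  assumes dx: "(x has_real_derivative x t * (1 - x t) * i t / t) (at t)"
    and dy: "(y has_real_derivative y t * (1 - y t) * i t / t) (at t)"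
    and di: "(i has_real_derivative (x t * (1 - x t) + y t * (1 - y t)) * i t ^ 3 / t) (at t)"
    and dA: "(A has_real_derivative P t * i t / t) (at t)"
    and dP: "(P has_real_derivative c * (x t * (1 - x t)) * A t * i t / t) (at t)"
    and dB: "(B has_real_derivative R t * i t / t) (at t)"
    and dR: "(R has_real_derivative c * (y t * (1 - y t)) * B t * i t / t) (at t)"
  shows "((\<lambda>t. A t * B t) has_real_derivative theta1 (i t) (A t) (P t) (B t) (R t) / t) (at t)"
    and "((\<lambda>t. theta1 (i t) (A t) (P t) (B t) (R t)) has_real_derivative
      theta2 c (x t) (y t) (i t) (A t) (P t) (B t) (R t) / t) (at t)"
    and "((\<lambda>t. theta2 c (x t) (y t) (i t) (A t) (P t) (B t) (R t)) has_real_derivative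
      theta3 c (x t) (y t) (i t) (A t) (P t) (B t) (R t) / t) (at t)"
proof -
  define j where "j = 1 / t"
  \<comment> \<open>Up to the factor \<open>i t / t\<close>, the derivative of \<open>A * B\<close>
    is \<open>Q\<close>, that of \<open>Q\<close> is \<open>N\<close>, that of \<open>N\<close> is
    \<open>N'\<close>, and that of \<open>g\<close> is \<open>m\<close>.\<close>
  define g where "g t = x t * (1 - x t) + y t * (1 - y t)" for t
  define m where "m = (1 - 2 * x t) * (x t * (1 - x t)) + (1 - 2 * y t) * (y t * (1 - y t))"
  define N where "N t = c * g t * A t * B t + 2 * P t * R t" for t
  define N' where "N' = c * m * A t * B t + c * g t * (P t * B t + A t * R t)
    + 2 * c * (x t * (1 - x t) * A t * R t + y t * (1 - y t) * P t * B t)"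
  define Q where "Q t = P t * B t + A t * R t" for t
  have j: "a / t = a * j" for a
    by (simp add: j_def)
  note d = dx[unfolded j] dy[unfolded j] dA[unfolded j] dP[unfolded j] dB[unfolded j] dR[unfolded j]
  have di: "(i has_real_derivative g t * i t ^ 3 * j) (at t)"
    using di by (simp add: g_def j)
  have AB: "((\<lambda>t. A t * B t) has_real_derivative Q t * i t * j) (at t)"
    unfolding Q_def by (rule derivative_eq_intros d refl)+ (simp add: algebra_simps)
  then show "((\<lambda>t. A t * B t) has_real_derivative theta1 (i t) (A t) (P t) (B t) (R t) / t) (at t)"
    unfolding Q_def theta1_def j .
  have dg: "(g has_real_derivative m * i t * j) (at t)"
    unfolding g_def m_def by (rule derivative_eq_intros d refl)+ (simp add: algebra_simps)
  have dQ: "(Q has_real_derivative N t * i t * j) (at t)"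
    unfolding Q_def N_def g_def by (rule derivative_eq_intros d refl)+ (simp add: algebra_simps)
  have dN: "(N has_real_derivative N' * i t * j) (at t)"
    unfolding N'_def N_def by (rule derivative_eq_intros d dg refl)+ (simp add: algebra_simps)
  have "((\<lambda>t. Q t * i t) has_real_derivative (N t * i t ^ 2 + g t * Q t * i t ^ 3) * j) (at t)"
    by (rule derivative_eq_intros dQ di refl)+ (simp add: algebra_simps power2_eq_square)
  then show "((\<lambda>t. theta1 (i t) (A t) (P t) (B t) (R t)) has_real_derivative
      theta2 c (x t) (y t) (i t) (A t) (P t) (B t) (R t) / t) (at t)"
    unfolding theta1_def theta2_def Let_def N_def g_def Q_def j .
  have "((\<lambda>t. N t * i t ^ 2 + g t * Q t * i t ^ 3) has_real_derivative
      (N' * i t ^ 3 + (3 * g t * N t + m * Q t) * i t ^ 4 + 3 * g t ^ 2 * Q t * i t ^ 5) * j) (at t)"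
    by (rule derivative_eq_intros dN dQ dg di refl)+ (simp add: algebra_simps eval_nat_numeral)
  then show "((\<lambda>t. theta2 c (x t) (y t) (i t) (A t) (P t) (B t) (R t)) has_real_derivative
      theta3 c (x t) (y t) (i t) (A t) (P t) (B t) (R t) / t) (at t)"
    unfolding theta2_def theta3_def Let_def N_def g_def m_def Q_def N'_def j .
qed

text \<open>Scaling \<open>(u, v) = (X * (1 - Y), Y * (1 - X))\<close> to \<open>(t * u, t * v)\<close> turns the factor \<open>n\<close> into
  \<open>t * d/dt\<close>; the square root below is \<open>1 - X - Y\<close> along this curve.\<close>

lemma bailey_theta_sums:
  fixes s X Y :: real
  assumes s: "0 < s" "s < 1" and X: "0 < X" and Y: "0 < Y" and XY: "X + Y < 1"
  defines "b \<equiv> \<lambda>n. hcoeff s n * legendre_hom n (X * (1 - Y)) (Y * (1 - X))"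
    and "A \<equiv> hfun s X" and "P \<equiv> X * (1 - X) * hderiv s X"
    and "B \<equiv> hfun s Y" and "R \<equiv> Y * (1 - Y) * hderiv s Y"
  shows "(\<lambda>n. real n * b n) sums theta1 (1 / (1 - X - Y)) A P B R"
    and "(\<lambda>n. real n ^ 2 * b n) sums theta2 (s * (1 - s)) X Y (1 / (1 - X - Y)) A P B R"
    and "(\<lambda>n. real n ^ 3 * b n) sums theta3 (s * (1 - s)) X Y (1 / (1 - X - Y)) A P B R"
proof -
  \<comment> \<open>Here p = u + v and u - v = X - Y, so \<open>rad t\<close> is the discriminant (1
    - t u - t v)^2 - 4 t^2 u v. The curve solves x (1 - y) = t u and y (1 - x) = t v, with x - y = t
    (X - Y) and x + y = 1 - r.\<close>
  define p where "p = X * (1 - Y) + Y * (1 - X)"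
  define rad where "rad t = 1 - 2 * t * p + (t * (X - Y))^2" for t
  define r where "r t = sqrt (rad t)" for t
  define x where "x t = (1 - r t + t * (X - Y)) / 2" for t
  define y where "y t = (1 - r t - t * (X - Y)) / 2" for t
  \<comment> \<open>The strict conditions cut out an open set around t = 1, as
    \<open>theta_sums\<close> requires, on which Bailey's formula applies along the curve.\<close>
  define S where "S = {t. 0 < t} \<inter> {t. 0 < rad t} \<inter> {t. 0 < x t} \<inter> {t. 0 < y t}"
  have crad: "continuous_on UNIV rad"
    unfolding rad_def by (intro continuous_intros)
  then have cr: "continuous_on UNIV r"
    unfolding r_def by (rule continuous_on_real_sqrt)
  have cx: "continuous_on UNIV x" and cy: "continuous_on UNIV y"
    unfolding x_def y_def by (intro continuous_intros cr; simp)+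
  have "open S"
    unfolding S_def using crad cx cy
    by (intro open_Int open_Collect_less continuous_on_const continuous_on_id)
  have rad1: "rad 1 = (1 - X - Y)^2"
    by (simp add: rad_def p_def power2_eq_square algebra_simps)
  then have r1: "r 1 = 1 - X - Y"
    unfolding r_def rad1 using XY by (intro real_sqrt_unique) auto
  then have xy1: "x 1 = X" "y 1 = Y"
    by (simp_all add: x_def y_def field_simps)
  have 1: "1 \<in> S"
    unfolding S_def using X Y XY by (auto simp: xy1 rad1)
  have rt: "r t ^ 2 = rad t" "0 < r t" "0 < t" if "t \<in> S" for t
    using that by (auto simp: S_def r_def)
  have xy: "x t * (1 - y t) = t * (X * (1 - Y))" "y t * (1 - x t) = t * (Y * (1 - X))" if "t \<in> S" for t
  proof -
    have "4 * (x t * (1 - y t)) = 1 - r t ^ 2 + 2 * t * (X - Y) + (t * (X - Y))^2"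
      by (simp add: x_def y_def power2_eq_square field_simps)
    then show "x t * (1 - y t) = t * (X * (1 - Y))"
      unfolding rt(1)[OF that] by (simp add: rad_def p_def algebra_simps)
    have "4 * (y t * (1 - x t)) = 1 - r t ^ 2 - 2 * t * (X - Y) + (t * (X - Y))^2"
      by (simp add: x_def y_def power2_eq_square field_simps)
    then show "y t * (1 - x t) = t * (Y * (1 - X))"
      unfolding rt(1)[OF that] by (simp add: rad_def p_def algebra_simps)
  qed
  have range: "0 < x t" "0 < y t" "x t + y t = 1 - r t" "\<bar>x t\<bar> < 1" "\<bar>y t\<bar> < 1" if "t \<in> S" for t
  proof -
    show "0 < x t" "0 < y t"
      using that by (auto simp: S_def)
    moreover show "x t + y t = 1 - r t"
      by (simp add: x_def y_def field_simps)
    ultimately show "\<bar>x t\<bar> < 1" "\<bar>y t\<bar> < 1"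
      using rt(2)[OF that] by auto
  qed
  have dr: "(r has_real_derivative ((t * (X - Y))^2 - t * p) / r t / t) (at t)" if "t \<in> S" for t
  proof -
    have "(r has_real_derivative (2 * (t * (X - Y)) * (X - Y) - 2 * p) * (inverse (r t) / 2)) (at t)"
      unfolding r_def rad_def
      by (rule derivative_eq_intros refl | use that in \<open>simp add: S_def rad_def\<close>)+
    also have "(2 * (t * (X - Y)) * (X - Y) - 2 * p) * (inverse (r t) / 2) = ((t * (X - Y))^2 - t * p) / r t / t"
      using rt[OF that] by (simp add: field_simps power2_eq_square)
    finally show ?thesis .
  qed
  have xx: "x t * (1 - x t) = (t * p - (t * (X - Y))^2 + r t * (t * (X - Y))) / 2"
    and yy: "y t * (1 - y t) = (t * p - (t * (X - Y))^2 - r t * (t * (X - Y))) / 2" if "t \<in> S" for t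
  proof -
    have "4 * (x t * (1 - x t)) = 1 - r t ^ 2 + 2 * r t * (t * (X - Y)) - (t * (X - Y))^2"
      "4 * (y t * (1 - y t)) = 1 - r t ^ 2 - 2 * r t * (t * (X - Y)) - (t * (X - Y))^2"
      by (simp_all add: x_def y_def power2_eq_square field_simps)
    then show "x t * (1 - x t) = (t * p - (t * (X - Y))^2 + r t * (t * (X - Y))) / 2"
      "y t * (1 - y t) = (t * p - (t * (X - Y))^2 - r t * (t * (X - Y))) / 2"
      unfolding rt(1)[OF that] by (simp_all add: rad_def field_simps)
  qed
  have dx: "(x has_real_derivative x t * (1 - x t) / r t / t) (at t)" if "t \<in> S" for t
  proof -
    have "(x has_real_derivative (- (((t * (X - Y))^2 - t * p) / r t / t) + (X - Y)) / 2) (at t)"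
      using DERIV_cdivide[OF DERIV_add[OF DERIV_diff[OF DERIV_const dr[OF that]] DERIV_cmult_right[OF DERIV_ident]], of 1 "X - Y" 2]
      unfolding x_def by simp
    also have "(- (((t * (X - Y))^2 - t * p) / r t / t) + (X - Y)) / 2 = x t * (1 - x t) / r t / t"
      unfolding xx[OF that] using rt[OF that] by (simp add: field_simps)
    finally show ?thesis .
  qed
  have dy: "(y has_real_derivative y t * (1 - y t) / r t / t) (at t)" if "t \<in> S" for t
  proof -
    have "(y has_real_derivative (- (((t * (X - Y))^2 - t * p) / r t / t) - (X - Y)) / 2) (at t)"
      using DERIV_cdivide[OF DERIV_diff[OF DERIV_diff[OF DERIV_const dr[OF that]] DERIV_cmult_right[OF DERIV_ident]], of 1 "X - Y" 2]
      unfolding y_def by simp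
    also have "(- (((t * (X - Y))^2 - t * p) / r t / t) - (X - Y)) / 2 = y t * (1 - y t) / r t / t"
      unfolding yy[OF that] using rt[OF that] by (simp add: field_simps)
    finally show ?thesis .
  qed
  have dr': "(r has_real_derivative - (x t * (1 - x t) + y t * (1 - y t)) / r t / t) (at t)" if "t \<in> S" for t
  proof -
    have "- (x t * (1 - x t) + y t * (1 - y t)) = (t * (X - Y))^2 - t * p"
      unfolding xx[OF that] yy[OF that] by (simp add: field_simps)
    then show ?thesis
      using dr[OF that] by simp
  qed
  define At where "At t = hfun s (x t)" for t
  define Bt where "Bt t = hfun s (y t)" for t
  define Pt where "Pt t = x t * (1 - x t) * hderiv s (x t)" for t
  define Rt where "Rt t = y t * (1 - y t) * hderiv s (y t)" for t
  have dA: "(At has_real_derivative Pt t / r t / t) (at t)" if "t \<in> S" for t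
    unfolding At_def Pt_def
    by (rule derivative_eq_intros dx[OF that] s range[OF that])+ simp
  have dB: "(Bt has_real_derivative Rt t / r t / t) (at t)" if "t \<in> S" for t
    unfolding Bt_def Rt_def
    by (rule derivative_eq_intros dy[OF that] s range[OF that])+ simp
  have dP: "(Pt has_real_derivative s * (1 - s) * (x t * (1 - x t)) * At t / r t / t) (at t)" if "t \<in> S" for t
    using DERIV_hfun_ode[OF dx[OF that] s range(4)[OF that]] unfolding At_def Pt_def
    by (simp add: mult_ac)
  have dR: "(Rt has_real_derivative s * (1 - s) * (y t * (1 - y t)) * Bt t / r t / t) (at t)" if "t \<in> S" for t
    using DERIV_hfun_ode[OF dy[OF that] s range(5)[OF that]] unfolding Bt_def Rt_def
    by (simp add: mult_ac)
  have t0: "t \<noteq> 0" "r t \<noteq> 0" if "t \<in> S" for t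
    using rt[OF that] by auto
  have di: "((\<lambda>t. 1 / r t) has_real_derivative (x t * (1 - x t) + y t * (1 - y t)) * (1 / r t) ^ 3 / t) (at t)"
    if "t \<in> S" for t
    by (rule derivative_eq_intros dr'[OF that] t0(2)[OF that] refl)+ (use t0[OF that] in \<open>simp add: field_simps power3_eq_cube\<close>)
  have m: "a / r t / t = a * (1 / r t) / t" for a t
    by simp
  note d = DERIV_theta[OF dx[unfolded m] dy[unfolded m] di dA[unfolded m] dP[unfolded m] dB[unfolded m] dR[unfolded m]]
  have 0: "(\<lambda>n. b n * t ^ n) sums (At t * Bt t)" if "t \<in> S" for t
  proof -
    have "x t + y t < 1"
      using range(3)[OF that] rt[OF that] by simp
    then show ?thesis
      using bailey_sums[OF s less_imp_le[OF range(1)[OF that]] less_imp_le[OF range(2)[OF that]]]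
      unfolding xy[OF that] legendre_hom_scale b_def At_def Bt_def by (simp add: mult_ac)
  qed
  note th = theta_sums[OF \<open>open S\<close> rt(3)]
  have 1: "(\<lambda>n. real n * b n * t ^ n) sums theta1 (1 / r t) (At t) (Pt t) (Bt t) (Rt t)" if "t \<in> S" for t
    by (rule th[OF _ 0 d(1) that])
  have 2: "(\<lambda>n. real n * (real n * b n) * t ^ n) sums
      theta2 (s * (1 - s)) (x t) (y t) (1 / r t) (At t) (Pt t) (Bt t) (Rt t)" if "t \<in> S" for t
    by (rule th[OF _ 1 d(2) that])
  have 3: "(\<lambda>n. real n * (real n * (real n * b n)) * t ^ n) sums
      theta3 (s * (1 - s)) (x t) (y t) (1 / r t) (At t) (Pt t) (Bt t) (Rt t)" if "t \<in> S" for t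
    by (rule th[OF _ 2 d(3) that])
  have v1: "At 1 = A" "Pt 1 = P" "Bt 1 = B" "Rt 1 = R"
    by (simp_all add: At_def Pt_def Bt_def Rt_def A_def P_def B_def R_def xy1)
  from 1[OF \<open>1 \<in> S\<close>] 2[OF \<open>1 \<in> S\<close>] 3[OF \<open>1 \<in> S\<close>]
  show "(\<lambda>n. real n * b n) sums theta1 (1 / (1 - X - Y)) A P B R"
    "(\<lambda>n. real n ^ 2 * b n) sums theta2 (s * (1 - s)) X Y (1 / (1 - X - Y)) A P B R"
    "(\<lambda>n. real n ^ 3 * b n) sums theta3 (s * (1 - s)) X Y (1 / (1 - X - Y)) A P B R"
    by (simp_all add: v1 xy1 r1 power2_eq_square power3_eq_cube mult.assoc)
qed

section \<open>Legendre polynomials and the modulus\<close>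

lemma legendre_conv_sum:
  "legendre n x = (\<Sum>j\<le>n. real (n choose j) * real ((n + j) choose j) * ((x - 1) / 2) ^ j)"
proof -
  have coeff: "pochhammer (- real n) j * pochhammer (real n + 1) j / (fact j * fact j)
      = (-1) ^ j * (real (n choose j) * real ((n + j) choose j))" for j
  proof -
    have "real (n choose j) = (-1) ^ j * pochhammer (- real n) j / fact j"
      by (simp add: binomial_gbinomial gbinomial_pochhammer)
    moreover have "real ((n + j) choose j) = pochhammer (real n + 1) j / fact j"
      by (simp add: binomial_gbinomial gbinomial_pochhammer')
    ultimately show ?thesis
      by simp
  qed
  have "legendre n x = (\<Sum>j. (-1) ^ j * (real (n choose j) * real ((n + j) choose j)) * ((1 - x) / 2) ^ j)"
    unfolding legendre_def eval_fps_def by (simp add: pochhammer_fact[symmetric] flip: coeff)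
  also have "\<dots> = (\<Sum>j. real (n choose j) * real ((n + j) choose j) * ((x - 1) / 2) ^ j)"
  proof -
    have "(-1) ^ j * ((1 - x) / 2) ^ j = ((x - 1) / 2) ^ j" for j
      by (simp flip: power_mult_distrib add: minus_divide_left)
    then have "(-1) ^ j * c * ((1 - x) / 2) ^ j = c * ((x - 1) / 2) ^ j" for j and c :: real
      by (metis mult.assoc mult.commute)
    then show ?thesis
      by (simp only:)
  qed
  also have "\<dots> = (\<Sum>j\<le>n. real (n choose j) * real ((n + j) choose j) * ((x - 1) / 2) ^ j)"
    by (rule suminf_finite) auto
  finally show ?thesis .
qed

text \<open>This is the case z = 1, where v = u + 1. Expanding the powers of w + 1 and collecting
  w^m leaves (n choose m) times a Vandermonde sum.\<close>

lemma legendre_conv_legendre_hom: "legendre n x = legendre_hom n ((x - 1) / 2) ((x + 1) / 2)"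
proof -
  define w where "w = (x - 1) / 2"
  have "legendre_hom n w (w + 1) = (\<Sum>j\<le>n. \<Sum>i\<le>n - j. real (n choose j) ^ 2 * real ((n - j) choose i) * w ^ (j + i))"
    unfolding legendre_hom_def
    by (intro sum.cong refl) (simp add: binomial_ring sum_distrib_left power_add mult_ac)
  also have "\<dots> = (\<Sum>(j, i)\<in>{(j, i). j + i \<le> n}. real (n choose j) ^ 2 * real ((n - j) choose i) * w ^ (j + i))"
    by (subst sum.Sigma) (auto intro!: sum.cong)
  also have "\<dots> = (\<Sum>m\<le>n. \<Sum>j\<le>m. real (n choose j) ^ 2 * real ((n - j) choose (m - j)) * w ^ (j + (m - j)))"
    by (rule sum.triangle_reindex_eq)
  also have "\<dots> = (\<Sum>m\<le>n. real (n choose m) * real ((n + m) choose m) * w ^ m)"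
  proof (intro sum.cong refl)
    fix m assume m: "m \<in> {..n}"
    have "(\<Sum>j\<le>m. (n choose j) ^ 2 * ((n - j) choose (m - j))) = (\<Sum>j\<le>m. (n choose m) * ((n choose j) * (m choose (m - j))))"
    proof (intro sum.cong refl)
      fix j assume "j \<in> {..m}"
      then show "(n choose j) ^ 2 * ((n - j) choose (m - j)) = (n choose m) * ((n choose j) * (m choose (m - j)))"
        using m choose_mult[of j m n] binomial_symmetric[of j m] by (simp add: power2_eq_square mult_ac)
    qed
    also have "\<dots> = (n choose m) * ((n + m) choose m)"
      by (simp add: vandermonde flip: sum_distrib_left)
    finally have "real (\<Sum>j\<le>m. (n choose j) ^ 2 * ((n - j) choose (m - j))) = real ((n choose m) * ((n + m) choose m))"
      by (rule arg_cong)
    then show "(\<Sum>j\<le>m. real (n choose j) ^ 2 * real ((n - j) choose (m - j)) * w ^ (j + (m - j)))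
        = real (n choose m) * real ((n + m) choose m) * w ^ m"
      by (simp flip: sum_distrib_right)
  qed
  also have "\<dots> = legendre n x"
    by (simp add: legendre_conv_sum w_def)
  finally have "legendre_hom n w (w + 1) = legendre n x" .
  moreover have "(x + 1) / 2 = w + 1"
    by (simp add: w_def field_simps)
  ultimately show ?thesis
    unfolding w_def[symmetric] by (simp only:)
qed

text \<open>The map k -> (1 - k) / (1 + 3k) is an involution exchanging 0 and 1, so the two
  arguments k^2 and \<open>modulus k\<close> swap roles under it.\<close>

definition modulus :: "real \<Rightarrow> real" where
  "modulus k = ((1 - k) / (1 + 3 * k)) ^ 2"

lemma one_minus_modulus:
  assumes "0 \<le> k"
  shows "1 - modulus k = 8 * k * (1 + k) / (1 + 3 * k) ^ 2"
  using assms by (simp add: modulus_def divide_simps) (simp add: power2_eq_square algebra_simps)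

lemma modulus_bounds:
  assumes "0 < k" "k < 1"
  shows "0 < modulus k" "modulus k < 1" "k^2 + modulus k < 1" "0 < k^2" "k^2 < 1"
    "1 - k^2 - modulus k = k * (1 - k) * (8 + 15 * k + 9 * k^2) / (1 + 3 * k) ^ 2"
proof -
  show eq: "1 - k^2 - modulus k = k * (1 - k) * (8 + 15 * k + 9 * k^2) / (1 + 3 * k) ^ 2"
    using assms by (simp add: modulus_def divide_simps) (simp add: power2_eq_square algebra_simps)
  have "0 < k * (1 - k) * (8 + 15 * k + 9 * k^2) / (1 + 3 * k) ^ 2"
    using assms by (intro divide_pos_pos mult_pos_pos add_pos_pos) auto
  then show "k^2 + modulus k < 1"
    unfolding eq[symmetric] by simp
  show "0 < modulus k"
    using assms by (simp add: modulus_def)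
  show "0 < k^2"
    using assms by simp
  then show "modulus k < 1" "k^2 < 1"
    using \<open>k^2 + modulus k < 1\<close> \<open>0 < modulus k\<close> by linarith+
qed

text \<open>Only z and z * x enter the homogeneous form, and in z * x the pole of x at 1/3 cancels
  against the zero of z.\<close>

lemma legendre_factor_eq:
  assumes "0 < k" "k \<noteq> 1 / 3"
  shows "legendre_factor n k = legendre_hom n (k^2 * (1 - modulus k)) (modulus k * (1 - k^2))"
proof -
  define z where "z = (1 + k) * (1 - 3 * k) * (1 + 3 * k^2) / (1 + 3 * k)^2"
  define x where "x = (1 + k) * (1 - 4 * k + 7 * k^2) / ((1 - 3 * k) * (1 + 3 * k^2))"
  have "0 < 1 + 3 * k^2"
    using zero_le_power2[of k] by linarith
  then have nz: "1 - 3 * k \<noteq> 0" "1 + 3 * k^2 \<noteq> 0" "1 + 3 * k \<noteq> 0"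
    using assms by auto
  have zx: "z * x = (1 + k)^2 * (1 - 4 * k + 7 * k^2) / (1 + 3 * k)^2"
    unfolding z_def x_def using nz by (simp add: power2_eq_square)
  have "z * ((x - 1) / 2) = (z * x - z) / 2" "z * ((x + 1) / 2) = (z * x + z) / 2"
    by (simp_all add: algebra_simps)
  moreover have "(z * x - z) / 2 = k^2 * (1 - modulus k)"
    unfolding zx unfolding z_def one_minus_modulus[OF less_imp_le[OF assms(1)]] using nz
    by (simp add: divide_simps) (simp add: power2_eq_square algebra_simps)
  moreover have "(z * x + z) / 2 = modulus k * (1 - k^2)"
    unfolding zx unfolding z_def modulus_def using nz
    by (simp add: divide_simps) (simp add: power2_eq_square algebra_simps)
  ultimately have "legendre_hom n (k^2 * (1 - modulus k)) (modulus k * (1 - k^2)) = z ^ n * legendre n x"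
    using legendre_hom_scale[of n z "(x - 1) / 2" "(x + 1) / 2"] by (simp add: legendre_conv_legendre_hom)
  then show ?thesis
    by (simp add: legendre_factor_def z_def x_def mult.commute)
qed

text \<open>At 1/3 the homogeneous form is continuous and agrees with \<open>legendre_factor\<close>
  nearby, so its value is the limit.\<close>

lemma legendre_term_eq:
  assumes "0 < k"
  shows "legendre_term n k = legendre_hom n (k^2 * (1 - modulus k)) (modulus k * (1 - k^2))"
proof (cases "k = 1 / 3")
  case True
  define f where "f k = legendre_hom n (k^2 * (1 - modulus k)) (modulus k * (1 - k^2))" for k
  have "isCont f (1 / 3)"
    unfolding f_def legendre_hom_def modulus_def by (intro continuous_intros) auto
  then have "(f \<longlongrightarrow> f (1 / 3)) (at (1 / 3))"
    by (simp add: isCont_def)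
  moreover have "eventually (\<lambda>k. k \<in> {0<..} - {1 / 3}) (at (1 / 3 :: real))"
    by (intro eventually_at_in_open) auto
  then have "eventually (\<lambda>k. f k = legendre_factor n k) (at (1 / 3))"
    by eventually_elim (simp add: legendre_factor_eq f_def)
  ultimately have "(legendre_factor n \<longlongrightarrow> f (1 / 3)) (at (1 / 3))"
    using tendsto_cong by force
  then show ?thesis
    unfolding True legendre_term_def by (simp add: tendsto_Lim flip: f_def)
qed (use assms in \<open>simp add: legendre_term_def legendre_factor_eq\<close>)

lemma DERIV_modulus:
  assumes "0 < k"
  shows "(modulus has_real_derivative - 8 * (1 - k) / (1 + 3 * k) ^ 3) (at k)"
proof -
  have "((\<lambda>k. (1 - k) / (1 + 3 * k)) has_real_derivative - 4 / (1 + 3 * k) ^ 2) (at k)"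
    using assms by (auto intro!: derivative_eq_intros simp: power2_eq_square algebra_simps)
  then show ?thesis
    unfolding modulus_def
    by (rule DERIV_cong[OF DERIV_power]) 
      (use assms in \<open>simp add: divide_simps, simp add: power2_eq_square power3_eq_cube algebra_simps\<close>)
qed

lemma filterlim_modulus: "filterlim modulus (at_left 1) (at_right 0)"
proof (rule tendsto_imp_filterlim_at_left)
  have "isCont modulus 0"
    unfolding modulus_def by (intro continuous_intros) auto
  then show "(modulus \<longlongrightarrow> 1) (at_right 0)"
    using filterlim_at_split isCont_def[of 0 modulus] by (force simp: modulus_def)
  show "eventually (\<lambda>k. modulus k < 1) (at_right 0)"
    by (rule eventually_at_rightI[of 0 1]) (auto intro: modulus_bounds(2))
qed

section \<open>Legendre's relation\<close>

text \<open>\<open>hfun (1/4) (k^2)\<close> and \<open>hfun (1/4) (modulus k) / sqrt (1 + 3 * k)\<close> solve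
  the same second-order equation \<open>(k * (1 - k^2) * f')' = 3/4 * k * f\<close>, and \<open>wronsk\<close> is, up to the
  factor \<open>- sqrt (1 + 3 * k)\<close>, their Wronskian times \<open>k * (1 - k^2)\<close>.\<close>

definition wronsk :: "real \<Rightarrow> real \<Rightarrow> real \<Rightarrow> real \<Rightarrow> real \<Rightarrow> real" where
  "wronsk k A P B R = (1 + 3 * k) * A * R + 3 * k * (1 - k^2) / (2 * (1 + 3 * k)) * A * B + 2 * P * B"

text \<open>As a function of k, the left side satisfies the first-order linear equation of sqrt(1 +
  3k), so their quotient is constant on (0, 1). Its limit as k tends to 0 from the right gives the
  constant.\<close>

lemma legendre_relation:
  assumes k: "0 < k" "k < 1"
  shows "wronsk k (hfun (1/4) (k^2)) (k^2 * (1 - k^2) * hderiv (1/4) (k^2))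
    (hfun (1/4) (modulus k)) (modulus k * (1 - modulus k) * hderiv (1/4) (modulus k))
    = sqrt (1 + 3 * k) * (sqrt 2 / (2 * pi))"
proof -
  define A where "A k = hfun (1/4) (k^2)" for k
  define P where "P k = k^2 * (1 - k^2) * hderiv (1/4) (k^2)" for k
  define B where "B k = hfun (1/4) (modulus k)" for k
  define R where "R k = modulus k * (1 - modulus k) * hderiv (1/4) (modulus k)" for k
  define N where "N k = wronsk k (A k) (P k) (B k) (R k)" for k
  have s: "0 < (1/4 :: real)" "1/4 < (1 :: real)"
    by simp_all
  have dN: "(N has_real_derivative 3 / (2 * (1 + 3 * x)) * N x) (at x)" if x: "0 < x" "x < 1" for x
  proof -
    have b: "\<bar>x^2\<bar> < 1" "\<bar>modulus x\<bar> < 1"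
      using modulus_bounds(1,2,5)[OF x] by auto
    \<comment> \<open>The reciprocals \<open>j\<close> and \<open>q\<close> stay symbolic, so the
      derivative of \<open>N\<close> is a polynomial that simplifies through the two products equal
      to 1.\<close>
    define j where "j = 1 / (x * (1 - x^2))"
    have j: "x * (1 - x^2) * j = 1"
      using modulus_bounds[OF x] x by (simp add: j_def)
    define q where "q = 1 / (1 + 3 * x)"
    have q: "(1 + 3 * x) * q = 1"
      using x by (simp add: q_def)
    have dx2: "((\<lambda>x. x^2) has_real_derivative 2 * x) (at x)"
      by (auto intro!: derivative_eq_intros)
    have dA: "(A has_real_derivative 2 * P x * j) (at x)"
    proof -
      have "(A has_real_derivative hderiv (1/4) (x^2) * (2 * x)) (at x)"
        unfolding A_def by (rule DERIV_hfun_comp[OF dx2 s b(1)])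
      also have "hderiv (1/4) (x^2) * (2 * x) = 2 * x * hderiv (1/4) (x^2) * (x * (1 - x^2) * j)"
        unfolding j by simp
      also have "\<dots> = 2 * P x * j"
        by (simp add: P_def power2_eq_square)
      finally show ?thesis .
    qed
    have dP: "(P has_real_derivative 3 / 8 * x * A x) (at x)"
      using DERIV_hfun_ode[OF dx2 s b(1)] unfolding P_def A_def by (simp add: mult_ac)
    have dB: "(B has_real_derivative - (1 + 3 * x) * R x * j) (at x)"
    proof -
      have "(B has_real_derivative hderiv (1/4) (modulus x) * (- 8 * (1 - x) / (1 + 3 * x) ^ 3)) (at x)"
        unfolding B_def by (rule DERIV_hfun_comp[OF DERIV_modulus[OF x(1)] s b(2)])
      also have "hderiv (1/4) (modulus x) * (- 8 * (1 - x) / (1 + 3 * x) ^ 3) = - (1 + 3 * x) * R x * j"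
        unfolding R_def one_minus_modulus[OF less_imp_le[OF x(1)]] unfolding modulus_def j_def
        using x modulus_bounds(5)[OF x]
        by (simp add: divide_simps) (simp add: eval_nat_numeral algebra_simps)
      finally show ?thesis .
    qed
    have dR: "(R has_real_derivative - 3 / 2 * (1 - x) * q^3 * B x) (at x)"
      unfolding R_def B_def q_def
      by (rule DERIV_cong[OF DERIV_hfun_ode[OF DERIV_modulus[OF x(1)] s b(2)]])
        (use x in \<open>simp add: divide_simps, simp add: algebra_simps\<close>)
    have "(N has_real_derivative
        3 * A x * R x + (1 + 3 * x) * (2 * P x * j * R x + A x * (- 3 / 2 * (1 - x) * q^3 * B x))
        + ((3 / 2 * (1 - 3 * x^2) * q - 9 / 2 * x * (1 - x^2) * q^2) * A x * B x
          + 3 / 2 * x * (1 - x^2) * q * (2 * P x * j * B x + A x * (- (1 + 3 * x) * R x * j)))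
        + 2 * (3 / 8 * x * A x * B x + P x * (- (1 + 3 * x) * R x * j))) (at x)"
      (is "(_ has_real_derivative ?V) _")
    proof -
      define c where "c x = 3 * x * (1 - x^2) / (2 * (1 + 3 * x))" for x :: real
      have c: "c x = 3 / 2 * x * (1 - x^2) * q"
        by (simp add: c_def q_def)
      have "((\<lambda>x. 3 * x * (1 - x^2)) has_real_derivative 3 * (1 - 3 * x^2)) (at x)"
        "((\<lambda>x. 2 * (1 + 3 * x)) has_real_derivative 6) (at x)"
        by (auto intro!: derivative_eq_intros simp: power2_eq_square algebra_simps)
      then have dc: "(c has_real_derivative 3 / 2 * (1 - 3 * x^2) * q - 9 / 2 * x * (1 - x^2) * q^2) (at x)"
        unfolding c_def
        by (rule DERIV_cong[OF DERIV_divide])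
          (use x in \<open>simp_all add: q_def divide_simps, simp add: power2_eq_square algebra_simps\<close>)
      have "(N has_real_derivative 3 * A x * R x + (1 + 3 * x) * (a * R x + A x * r)
          + (c' * A x * B x + c x * (a * B x + A x * b)) + 2 * (p * B x + P x * b)) (at x)"
        if "(A has_real_derivative a) (at x)" "(P has_real_derivative p) (at x)" "(B has_real_derivative b) (at x)"
          "(R has_real_derivative r) (at x)" "(c has_real_derivative c') (at x)" for a p b r c'
        unfolding N_def wronsk_def c_def[symmetric]
        by (rule that derivative_eq_intros refl)+ (simp add: algebra_simps)
      from this[OF dA dP dB dR dc] show ?thesis
        unfolding c by (simp only: mult.assoc)
    qed
    \<comment> \<open>The terms in \<open>P * R\<close> cancel; the others are grouped around the
      products equal to 1.\<close>
    also have "?V = 3 * A x * R x + (3 / 2 * (1 - 3 * x^2) * q - 9 / 2 * x * (1 - x^2) * q^2 + 3 / 4 * x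
          - 3 / 2 * (1 - x) * q^2 * ((1 + 3 * x) * q)) * A x * B x
        + 3 * q * P x * B x * (x * (1 - x^2) * j) - 3 / 2 * A x * R x * (x * (1 - x^2) * j) * ((1 + 3 * x) * q)"
      by (simp add: algebra_simps power2_eq_square power3_eq_cube) (simp add: field_simps)
    also have "\<dots> = 3 / 2 * A x * R x + (3 / 2 * (1 - 3 * x^2) * q - 9 / 2 * x * (1 - x^2) * q^2 + 3 / 4 * x
          - 3 / 2 * (1 - x) * q^2) * A x * B x + 3 * q * P x * B x"
      unfolding j q by simp
    also have "3 / 2 * (1 - 3 * x^2) * q - 9 / 2 * x * (1 - x^2) * q^2 + 3 / 4 * x - 3 / 2 * (1 - x) * q^2
        = 9 / 4 * x * (1 - x^2) * q^2"
      using x unfolding q_def by (simp add: divide_simps) (simp add: power2_eq_square algebra_simps)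
    also have "3 / 2 * A x * R x + 9 / 4 * x * (1 - x^2) * q^2 * A x * B x + 3 * q * P x * B x
        = 3 / 2 * ((1 + 3 * x) * q) * A x * R x + 9 / 4 * x * (1 - x^2) * q^2 * A x * B x + 3 * q * P x * B x"
      unfolding q by simp
    also have "\<dots> = 3 / 2 * q * ((1 + 3 * x) * A x * R x + 3 / 2 * x * (1 - x^2) * q * A x * B x + 2 * P x * B x)"
      by (simp add: field_simps power2_eq_square)
    also have "\<dots> = 3 / (2 * (1 + 3 * x)) * N x"
      by (simp add: N_def wronsk_def q_def)
    finally show ?thesis .
  qed
  define M where "M x = N x / sqrt (1 + 3 * x)" for x
  have dM: "(M has_real_derivative 0) (at x)" if x: "0 < x" "x < 1" for x
  proof -
    define q where "q = sqrt (1 + 3 * x)"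
    have q: "0 < q" "1 + 3 * x = q * q"
      using x by (simp_all add: q_def)
    have "((\<lambda>x. sqrt (1 + 3 * x)) has_real_derivative 3 / (2 * q)) (at x)"
      unfolding q_def using x by (auto intro!: derivative_eq_intros simp: field_simps)
    from DERIV_divide[OF dN[OF x] this] show ?thesis
      unfolding M_def using q by (simp flip: q_def)
  qed
  have const: "M x = M k" if "0 < x" "x < 1" for x
  proof -
    have "\<exists>c. \<forall>x\<in>{0<..<1}. M x = c"
      by (rule has_field_derivative_zero_constant) (auto intro: has_field_derivative_at_within dM)
    then show ?thesis
      using that k by auto
  qed
  have lim: "(N \<longlongrightarrow> sqrt 2 / (2 * pi)) (at_right 0)"
  proof -
    \<comment> \<open>All terms of \<open>N\<close> but the one in \<open>A * R\<close> contain
      \<open>B\<close>. Their coefficient has a factor x, as does \<open>1 - modulus x\<close>; the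
      quotient \<open>W\<close> is continuous at 0, so \<open>hfun_asymp\<close> makes these terms
      vanish in the limit.\<close>
    define W where "W x = (1 + 3 * x)^2 / (8 * (1 + x)) * (3 * (1 - x^2) / (2 * (1 + 3 * x)) * A x
      + 2 * x * (1 - x^2) * hderiv (1/4) (x^2))" for x
    have h: "isCont (hfun (1/4)) (0^2)" "isCont (hderiv (1/4)) (0^2)"
    proof -
      show "isCont (hfun (1/4)) (0^2)"
        by (rule DERIV_isCont[OF DERIV_hfun]) auto
      have "summable (\<lambda>n. diffs (hcoeff (1/4)) n * (1/2) ^ n)"
        using hderiv_sums[OF s, of "1/2"] by (simp add: sums_iff)
      then show "isCont (hderiv (1/4)) (0^2)"
        unfolding hderiv_def by (rule isCont_powser) simp
    qed
    have sq: "isCont (\<lambda>x :: real. x^2) 0"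
      by (intro continuous_intros)
    have A: "isCont A 0"
      unfolding A_def by (rule isCont_o2[OF sq h(1)])
    have W: "isCont W 0"
      unfolding W_def by (intro continuous_intros A isCont_o2[OF sq h(2)]) simp_all
    have lims: "(W \<longlongrightarrow> W 0) (at_right 0)" "(A \<longlongrightarrow> 1) (at_right 0)" "(modulus \<longlongrightarrow> 1) (at_right 0)"
      using W A filterlim_modulus by (auto simp: isCont_def A_def filterlim_at_split filterlim_at)
    have "((\<lambda>x. (1 - modulus x) * hderiv (1/4) (modulus x)) \<longlongrightarrow> sin (pi * (1/4)) / pi) (at_right 0)"
      by (rule filterlim_compose[OF hderiv_asymp[OF s] filterlim_modulus])
    moreover have "((\<lambda>x. (1 - modulus x) * hfun (1/4) (modulus x)) \<longlongrightarrow> 0) (at_right 0)"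
      by (rule filterlim_compose[OF hfun_asymp[OF s] filterlim_modulus])
    ultimately have "((\<lambda>x. (1 + 3 * x) * A x * (modulus x * ((1 - modulus x) * hderiv (1/4) (modulus x)))
        + W x * ((1 - modulus x) * hfun (1/4) (modulus x))) \<longlongrightarrow>
        (1 + 3 * 0) * 1 * (1 * (sin (pi * (1/4)) / pi)) + W 0 * 0) (at_right 0)"
      by (intro tendsto_intros lims)
    moreover have "eventually (\<lambda>x. (1 + 3 * x) * A x * (modulus x * ((1 - modulus x) * hderiv (1/4) (modulus x)))
        + W x * ((1 - modulus x) * hfun (1/4) (modulus x)) = N x) (at_right 0)"
    proof (rule eventually_at_rightI[of 0 1])
      fix x :: real assume "x \<in> {0<..<1}"
      then have x: "0 < x" "x < 1"
        by auto
      have "W x * (1 - modulus x) = 3 * x * (1 - x^2) / (2 * (1 + 3 * x)) * A x + 2 * P x"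
        unfolding one_minus_modulus[OF less_imp_le[OF x(1)]] W_def P_def using x
        by (simp add: divide_simps) (simp add: power2_eq_square algebra_simps)
      then show "(1 + 3 * x) * A x * (modulus x * ((1 - modulus x) * hderiv (1/4) (modulus x)))
          + W x * ((1 - modulus x) * hfun (1/4) (modulus x)) = N x"
        unfolding N_def wronsk_def R_def mult.assoc[symmetric, of "W x"]
        by (simp only: distrib_right) (simp add: B_def mult_ac)
    qed simp
    moreover have "sin (pi * (1/4)) / pi = sqrt 2 / (2 * pi)"
      by (simp add: sin_45)
    ultimately show ?thesis
      using tendsto_cong by force
  qed
  have "(M \<longlongrightarrow> sqrt 2 / (2 * pi) / sqrt (1 + 3 * 0)) (at_right 0)"
    unfolding M_def by (intro tendsto_intros lim) auto
  moreover have "eventually (\<lambda>x. M x = M k) (at_right 0)"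
    by (rule eventually_at_rightI[of 0 1]) (auto intro: const)
  ultimately have "((\<lambda>_. M k) \<longlongrightarrow> sqrt 2 / (2 * pi)) (at_right (0::real))"
    using tendsto_cong by force
  then have "M k = sqrt 2 / (2 * pi)"
    by (simp add: tendsto_const_iff)
  then have "N k = sqrt (1 + 3 * k) * (sqrt 2 / (2 * pi))"
    using k by (simp add: M_def field_simps)
  then show ?thesis
    unfolding N_def A_def P_def B_def R_def .
qed

text \<open>\<open>C3\<close> absorbs two factors \<open>i\<close>, and \<open>C2\<close> cancels
  the terms in \<open>P * R\<close> together with all others that keep a power \<open>i^2\<close> or
  \<open>i^3\<close>. Only \<open>A * B\<close>, \<open>A * R * i\<close> and
  \<open>P * B * i\<close> survive; \<open>C1\<close> and \<open>C0\<close> make their coefficients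
  proportional to those of \<open>wronsk\<close>, which is \<open>I1\<close>, \<open>I2\<close>,
  \<open>I3\<close>.\<close>

lemma theta_combination:
  fixes A P B R k :: real
  assumes k: "0 < k" "k < 1"
  shows "C3 k * theta3 (3/16) (k^2) (modulus k) (1 / (1 - k^2 - modulus k)) A P B R
      + C2 k * theta2 (3/16) (k^2) (modulus k) (1 / (1 - k^2 - modulus k)) A P B R
      + C1 k * theta1 (1 / (1 - k^2 - modulus k)) A P B R + C0 k * (A * B)
    = 6 * (1 + 3 * k)^2 * (1 + 3 * k^2) / (1 + k) * wronsk k A P B R"
proof -
  define x where "x = k^2"
  define y where "y = modulus k"
  define D where "D = 1 - x - y"
  define g where "g = x * (1 - x) + y * (1 - y)"
  define m where "m = (1 - 2 * x) * (x * (1 - x)) + (1 - 2 * y) * (y * (1 - y))"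
  \<comment> \<open>The cofactor of \<open>D\<close> in \<open>m\<close>: divisibility by
    \<open>D\<close> lowers the power of \<open>i\<close> once more and frees the
    \<open>A * B\<close> term of denominators.\<close>
  define \<mu> where "\<mu> = x + y - 2 * x^2 - 2 * y^2 + 2 * x * y"
  define T where "T = 16 * (1 + 3 * k)^4 / (1 + k)^2"
  define E where "E = 6 * (1 + 3 * k)^2 * (1 + 3 * k^2) / (1 + k)"
  have D: "D = k * (1 - k) * (8 + 15 * k + 9 * k^2) / (1 + 3 * k) ^ 2"
    unfolding D_def x_def y_def by (rule modulus_bounds(6)[OF k])
  have D0: "D \<noteq> 0"
    using modulus_bounds(3)[OF k] by (simp add: D_def x_def y_def)
  have nz: "1 + k \<noteq> 0" "1 + 3 * k \<noteq> 0"
    using k by auto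
  have m: "m = D * \<mu>"
    by (simp add: m_def D_def \<mu>_def power2_eq_square algebra_simps)
  have C3: "C3 k = T * D^2"
    unfolding C3_def T_def D using nz
    by (simp add: divide_simps) (simp add: power2_eq_square eval_nat_numeral algebra_simps)
  have C2: "C2 k = - 3 * g * T"
    unfolding C2_def T_def g_def x_def y_def modulus_def using nz
    by (simp add: divide_simps) (simp add: eval_nat_numeral algebra_simps)
  have I1: "3/16 * \<mu> * T + C0 k = E * (3 * k * (1 - k^2) / (2 * (1 + 3 * k)))"
    unfolding C0_def T_def \<mu>_def x_def y_def modulus_def E_def using nz
    by (simp add: divide_simps) (simp add: eval_nat_numeral algebra_simps)
  have I2: "3/16 * g * T + \<mu> * T + C1 k + 3/8 * T * (x * (1 - x)) = E * (1 + 3 * k) * D"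
    unfolding C1_def T_def \<mu>_def g_def D x_def y_def modulus_def E_def using nz
    by (simp add: divide_simps) (simp add: eval_nat_numeral algebra_simps)
  have I3: "3/16 * g * T + \<mu> * T + C1 k + 3/8 * T * (y * (1 - y)) = E * 2 * D"
    unfolding C1_def T_def \<mu>_def g_def D x_def y_def modulus_def E_def using nz
    by (simp add: divide_simps) (simp add: eval_nat_numeral algebra_simps)
  define i where "i = 1 / D"
  have i: "D * i = 1"
    using D0 by (simp add: i_def)
  have t1: "theta1 i A P B R = (P * B + A * R) * i"
    by (simp add: theta1_def)
  have t2: "theta2 (3/16) x y i A P B R
      = (3/16 * g * A * B + 2 * P * R) * i^2 + g * (P * B + A * R) * i^3"
    by (simp add: theta2_def Let_def g_def)
  have t3: "theta3 (3/16) x y i A P B R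
      = (3/16 * m * A * B + 3/16 * g * (P * B + A * R) + 2 * (3/16) * (x * (1 - x) * A * R + y * (1 - y) * P * B)) * i^3
      + (3 * g * (3/16 * g * A * B + 2 * P * R) + m * (P * B + A * R)) * i^4
      + 3 * g^2 * (P * B + A * R) * i^5"
    by (simp add: theta3_def Let_def g_def m_def)
  have "C3 k * theta3 (3/16) x y i A P B R + C2 k * theta2 (3/16) x y i A P B R
      + C1 k * theta1 i A P B R + C0 k * (A * B)
    = A * B * (3/16 * \<mu> * T + C0 k)
      + A * R * i * (3/16 * g * T + \<mu> * T + C1 k + 3/8 * T * (x * (1 - x)))
      + P * B * i * (3/16 * g * T + \<mu> * T + C1 k + 3/8 * T * (y * (1 - y)))"
  proof -
    have i': "T * D^2 * i^3 = T * i" "T * D^2 * i^4 = T * i^2" "T * D^2 * i^5 = T * i^3"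
      "T * D^2 * (D * \<mu>) * i^3 = T * \<mu>" "T * D^2 * (D * \<mu>) * i^4 = T * \<mu> * i"
      using i by algebra+
    define c where "c = T * D^2"
    \<comment> \<open>Naming 3/16 keeps it an atom while the terms are matched.\<close>
    define e where "e = (3/16 :: real)"
    have e: "3/16 = e" "3/8 = 2 * e"
      by (simp_all add: e_def)
    have "c * theta3 e x y i A P B R
      = e * (c * m * i^3) * A * B + (c * i^3) * (e * g * (P * B + A * R)
          + 2 * e * (x * (1 - x) * A * R + y * (1 - y) * P * B))
      + (c * i^4) * (3 * g * (e * g * A * B + 2 * P * R)) + (c * m * i^4) * (P * B + A * R)
      + (c * i^5) * (3 * g^2 * (P * B + A * R))"
      unfolding t3[unfolded e] by (simp add: algebra_simps)
    then have "C3 k * theta3 e x y i A P B R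
      = e * (T * \<mu>) * A * B + (T * i) * (e * g * (P * B + A * R)
          + 2 * e * (x * (1 - x) * A * R + y * (1 - y) * P * B))
      + (T * i^2) * (3 * g * (e * g * A * B + 2 * P * R)) + (T * \<mu> * i) * (P * B + A * R)
      + (T * i^3) * (3 * g^2 * (P * B + A * R))"
      unfolding C3 c_def m i' .
    then show ?thesis
      unfolding C2 t1 e t2[unfolded e] by (simp only:) (simp add: algebra_simps power2_eq_square)
  qed
  also have "\<dots> = E * (A * B * (3 * k * (1 - k^2) / (2 * (1 + 3 * k))) + A * R * (1 + 3 * k) * (D * i) + P * B * 2 * (D * i))"
    unfolding I1 I2 I3 by (simp add: algebra_simps)
  also have "\<dots> = E * wronsk k A P B R"
    unfolding i by (simp add: wronsk_def algebra_simps)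
  finally show ?thesis
    unfolding x_def y_def i_def D_def E_def .
qed

theorem theorem3:
  fixes k :: real
  assumes "0 < k" and "k < 1"
  shows "(\<lambda>n. pochhammer (1/4 :: real) n * pochhammer (3/4) n / (fact n)^2
             * legendre_term n k
             * (C3 k * real n ^ 3 + C2 k * real n ^ 2 + C1 k * real n + C0 k))
         sums (3 * sqrt 2 * (1 + 3 * k) powr (5/2) * (1 + 3 * k^2) / ((1 + k) * pi))"
proof -
  define b where "b n = hcoeff (1/4) n * legendre_hom n (k^2 * (1 - modulus k)) (modulus k * (1 - k^2))" for n
  have b: "pochhammer (1/4) n * pochhammer (3/4) n / (fact n)^2 * legendre_term n k = b n" for n
    by (simp add: b_def hcoeff_def legendre_term_eq assms)
  have s: "0 < (1/4 :: real)" "1/4 < (1 :: real)"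
    by simp_all
  note mb = modulus_bounds[OF assms]
  note th = bailey_theta_sums[OF s mb(4) mb(1) mb(3), folded b_def]
  have c: "(1/4 * (1 - 1/4) :: real) = 3/16"
    by simp
  have 0: "b sums (hfun (1/4) (k^2) * hfun (1/4) (modulus k))"
    using bailey_sums[OF s _ _ mb(3)] mb by (simp add: b_def[abs_def])
  have "1 + 3 * k > 0"
    using assms by simp
  then have pw: "(1 + 3 * k) powr (5/2) = (1 + 3 * k)^2 * sqrt (1 + 3 * k)"
    using powr_add[of "1 + 3 * k" 2 "1/2"] by (simp add: powr_half_sqrt)
  \<comment> \<open>Rewriting the value backwards through both identities turns it into the
    combination of the Euler iterates, so linearity suffices.\<close>
  have "(\<lambda>n. C3 k * (real n ^ 3 * b n) + C2 k * (real n ^ 2 * b n) + C1 k * (real n * b n) + C0 k * b n) sums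
      (6 * (1 + 3 * k)^2 * (1 + 3 * k^2) / (1 + k) * (sqrt (1 + 3 * k) * (sqrt 2 / (2 * pi))))"
    unfolding legendre_relation[OF assms, symmetric] theta_combination[OF assms, symmetric]
    by (intro sums_add sums_mult th[unfolded c] 0)
  moreover have "6 * (1 + 3 * k)^2 * (1 + 3 * k^2) / (1 + k) * (sqrt (1 + 3 * k) * (sqrt 2 / (2 * pi)))
      = 3 * sqrt 2 * (1 + 3 * k) powr (5/2) * (1 + 3 * k^2) / ((1 + k) * pi)"
    unfolding pw by (simp add: mult_ac)
  moreover have "b n * (C3 k * real n ^ 3 + C2 k * real n ^ 2 + C1 k * real n + C0 k)
      = C3 k * (real n ^ 3 * b n) + C2 k * (real n ^ 2 * b n) + C1 k * (real n * b n) + C0 k * b n" for n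
    by (simp add: algebra_simps)
  ultimately show ?thesis
    unfolding b by simp
qed

end
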